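(* Let $n\ge 0$ be an integer, let $\nu\in\mathbb{R}$, and let $t\in\mathbb{C}$ with $\Re t>0$. Then $$\frac{\partial^{n}}{\partial\nu^{n}}I_{\nu}(t)=\frac{1}{\pi}\int_{0}^{\pi}x^{n}e^{t\cos x}\cos\left(\nu x+\frac{\pi}{2}n\right)dx-\frac{1}{\pi}\int_{0}^{\infty}e^{-t\cosh x-\nu x}\,\Im\left[(i\pi-x)^{n}e^{i\pi\nu}\right]dx$$ $$=\frac{1}{\pi}\int_{0}^{\pi}x^{n}e^{t\cos x}\cos\left(\nu x+\frac{\pi}{2}n\right)dx-\frac{1}{\pi}\int_{0}^{\infty}e^{-t\cosh x-\nu x}\left[p_{n}(x)\sin\pi\nu+q_{n}(x)\cos\pi\nu\right]dx .$$
   Context: $I_\nu(t)=\sum_{k=0}^{\infty}\frac{1}{k!\,\Gamma(k+\nu+1)}\left(\frac{t}{2}\right)^{2k+\nu}$ is the modified Bessel function of the first kind (principal branch, $-\pi<\arg t\le\pi$; $1/\Gamma$ is zero at the poles of $\Gamma$). $\Re$ and $\Im$ denote real and imaginary parts. For real $x$, the polynomials $p_n,q_n$ are $p_{n}(x)=\Re\left[(i\pi-x)^{n}\right]=\sum_{k=0}^{\lfloor n/2\rfloor}\binom{n}{2k}(-1)^{n+k}\pi^{2k}x^{n-2k}$ and $q_{n}(x)=\Im\left[(i\pi-x)^{n}\right]=\sum_{k=0}^{\lfloor (n-1)/2\rfloor}\binom{n}{2k+1}(-1)^{n+k+1}\pi^{2k+1}x^{n-2k-1}$ (empty sums are $0$).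 *)

theory Defs
  imports "HOL-Analysis.Analysis"
begin

text \<open>Complex \<open>powr\<close> is the principal power, with argument in \<open>(-\<pi>, \<pi>]\<close>, and
  \<open>rGamma = 1 / \<Gamma>\<close> is entire, vanishing at the poles of \<open>\<Gamma>\<close>.
  The value at \<open>t = 0\<close> is a junk value, because \<open>0 powr a = 0\<close> for all \<open>a\<close>.\<close>

definition bessel_I :: "complex \<Rightarrow> complex \<Rightarrow> complex" where
  "bessel_I \<nu> t =
     (\<Sum>k. rGamma (of_nat k + \<nu> + 1) / fact k * (t / 2) powr (2 * of_nat k + \<nu>))"

text \<open>The library's \<open>deriv\<close> needs the same field as domain and codomain, so iterated derivatives of
  functions of a real variable are built from \<open>vector_derivative\<close>. As that is a total
  function, differentiability has to be stated separately.\<close>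

definition nth_vector_derivative ::
    "nat \<Rightarrow> (real \<Rightarrow> 'a::real_normed_vector) \<Rightarrow> real \<Rightarrow> 'a" where
  "nth_vector_derivative n f = ((\<lambda>g x. vector_derivative g (at x)) ^^ n) f"

definition p_poly :: "nat \<Rightarrow> real \<Rightarrow> real" where
  "p_poly n x = Re ((\<i> * of_real pi - of_real x) ^ n)"

definition q_poly :: "nat \<Rightarrow> real \<Rightarrow> real" where
  "q_poly n x = Im ((\<i> * of_real pi - of_real x) ^ n)"

lemma pq_term_even:
  "(\<i> * of_real pi) ^ (2 * k) * (- of_real x :: complex) ^ m
     = of_real ((-1) ^ (k + m) * pi ^ (2 * k) * x ^ m)"
proof -
  have "(- of_real x :: complex) ^ m = (-1) ^ m * of_real x ^ m" by (rule power_minus)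
  moreover have "(- (complex_of_real pi)\<^sup>2) ^ k = (-1) ^ k * ((complex_of_real pi)\<^sup>2) ^ k"
    by (rule power_minus)
  ultimately show ?thesis by (simp add: power_mult_distrib power_mult power_add)
qed

lemma pq_term_odd:
  "(\<i> * of_real pi) ^ (2 * k + 1) * (- of_real x :: complex) ^ m
     = \<i> * of_real ((-1) ^ (k + m) * pi ^ (2 * k + 1) * x ^ m)"
  using pq_term_even[of k x m] by (simp add: mult_ac)

lemma pq_binomial:
  "(\<i> * of_real pi - of_real x) ^ n =
     (\<Sum>j\<le>n. of_nat (n choose j) * ((\<i> * of_real pi) ^ j * (- of_real x :: complex) ^ (n - j)))"
  using binomial_ring[of "\<i> * of_real pi" "- of_real x :: complex" n]
  by (simp add: mult.assoc)

lemma p_poly_eq_sum: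
  "p_poly n x =
     (\<Sum>k\<le>n div 2. real (n choose (2 * k)) * (-1) ^ (n + k) * pi ^ (2 * k) * x ^ (n - 2 * k))"
proof -
  let ?f = "\<lambda>j. of_nat (n choose j) * ((\<i> * of_real pi) ^ j * (- of_real x :: complex) ^ (n - j))"
  have odd: "Re (?f j) = 0" if "odd j" for j
    using that by (elim oddE) (simp only: pq_term_odd, simp del: of_real_mult of_real_power)
  have even: "Re (?f (2 * k)) =
      real (n choose (2 * k)) * (-1) ^ (n + k) * pi ^ (2 * k) * x ^ (n - 2 * k)"
    if "k \<le> n div 2" for k
  proof -
    have "(-1 :: real) ^ (k + (n - 2 * k)) = (-1) ^ (n + k)"
      using that by (auto simp: minus_one_power_iff)
    then show ?thesis
      unfolding pq_term_even by (simp del: of_real_mult of_real_power)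
  qed
  have "p_poly n x = (\<Sum>j\<le>n. Re (?f j))"
    by (simp only: p_poly_def pq_binomial Re_sum)
  also have "\<dots> = (\<Sum>j\<in>(\<lambda>k. 2 * k) ` {..n div 2}. Re (?f j))"
  proof (rule sum.mono_neutral_right)
    show "\<forall>j\<in>{..n} - (\<lambda>k. 2 * k) ` {..n div 2}. Re (?f j) = 0"
    proof
      fix j assume j: "j \<in> {..n} - (\<lambda>k. 2 * k) ` {..n div 2}"
      have "odd j"
      proof
        assume "even j"
        then obtain k where "j = 2 * k" by (elim evenE)
        with j show False by auto
      qed
      then show "Re (?f j) = 0" by (rule odd)
    qed
  qed auto
  also have "\<dots> = (\<Sum>k\<le>n div 2. Re (?f (2 * k)))"
    by (subst sum.reindex) (auto simp: inj_on_def)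
  also have "\<dots> = (\<Sum>k\<le>n div 2.
      real (n choose (2 * k)) * (-1) ^ (n + k) * pi ^ (2 * k) * x ^ (n - 2 * k))"
    by (intro sum.cong refl even) simp
  finally show ?thesis .
qed

lemma q_poly_eq_sum:
  "q_poly n x =
     (\<Sum>k<(n + 1) div 2. real (n choose (2 * k + 1)) * (-1) ^ (n + k + 1)
        * pi ^ (2 * k + 1) * x ^ (n - 2 * k - 1))"
proof -
  let ?f = "\<lambda>j. of_nat (n choose j) * ((\<i> * of_real pi) ^ j * (- of_real x :: complex) ^ (n - j))"
  have even: "Im (?f j) = 0" if "even j" for j
    using that by (elim evenE) (simp only: pq_term_even, simp del: of_real_mult of_real_power)
  have odd: "Im (?f (2 * k + 1)) = real (n choose (2 * k + 1)) * (-1) ^ (n + k + 1)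
        * pi ^ (2 * k + 1) * x ^ (n - 2 * k - 1)"
    if "k < (n + 1) div 2" for k
  proof -
    have "(-1 :: real) ^ (k + (n - (2 * k + 1))) = (-1) ^ (n + k + 1)"
    proof -
      have "2 * k + 1 \<le> n" using that by linarith
      then show ?thesis by (auto simp: minus_one_power_iff)
    qed
    then show ?thesis
      unfolding pq_term_odd by (simp del: of_real_mult of_real_power power_Suc)
  qed
  have "q_poly n x = (\<Sum>j\<le>n. Im (?f j))"
    by (simp only: q_poly_def pq_binomial Im_sum)
  also have "\<dots> = (\<Sum>j\<in>(\<lambda>k. 2 * k + 1) ` {..<(n + 1) div 2}. Im (?f j))"
  proof (rule sum.mono_neutral_right)
    show "\<forall>j\<in>{..n} - (\<lambda>k. 2 * k + 1) ` {..<(n + 1) div 2}. Im (?f j) = 0"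
    proof
      fix j assume j: "j \<in> {..n} - (\<lambda>k. 2 * k + 1) ` {..<(n + 1) div 2}"
      have "even j"
      proof (rule ccontr)
        assume "odd j"
        then obtain k where "j = 2 * k + 1" by (elim oddE)
        with j show False by auto
      qed
      then show "Im (?f j) = 0" by (rule even)
    qed
  qed auto
  also have "\<dots> = (\<Sum>k<(n + 1) div 2. Im (?f (2 * k + 1)))"
    by (subst sum.reindex) (auto simp: inj_on_def)
  also have "\<dots> = (\<Sum>k<(n + 1) div 2. real (n choose (2 * k + 1)) * (-1) ^ (n + k + 1)
        * pi ^ (2 * k + 1) * x ^ (n - 2 * k - 1))"
    by (intro sum.cong refl odd) simp
  finally show ?thesis .
qed

end

(* Schlaefli's representation of I_nu (the case n = 0) comes from Hankel's integral for 1/Gamma over a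
   contour made of a circle of radius r and the negative ray beyond it: expanding e^{t^2/(4s)} inside
   Hankel's integral with r = t/2 produces the Bessel series. Hankel's integral itself is checked for
   real mu < 0, where the contour can be collapsed onto the cut: the circle contributes the missing
   lower incomplete Gamma integral, and the reflection formula finishes. The identity theorem extends
   it to all mu, and the representation from t > 0 to Re t > 0. Every integral has the form
   M(z) = int h e^{a z}, which is a power series in z with the moments of a as coefficients; so
   M' = int h a e^{a z}, and the n-th derivative in nu inserts the factor a^n. *)

theory Submission
  imports Defs "HOL-Complex_Analysis.Conformal_Mappings"
begin

section \<open>Exponential integrals depending on a parameter\<close>

text \<open>No contour is ever deformed. With z = r e^(ix) on the circle and z = r e^x
  e^(\<plusminus>i pi) on the two sides of the cut, Hankel's contour is encoded by integrals over
  real intervals, and for \<mu> = -\<sigma> < 0 their value is found by comparing power series in r.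
  The condition \<sigma> > 0 makes u^(\<sigma>-1) integrable at 0, so that the lower incomplete
  Gamma integral exists at all.

  The radius r = t/2 makes t^2/(4z) = r^2/z the conjugate of z on the circle, hence z + r^2/z = t
  cos x; on the cut r^2/z = -r e^(-x), hence z + r^2/z = -t cosh x. A radius is positive, so this
  argument is confined to real t > 0.

  The ray term carries a factor sin(pi \<nu>), which also depends on \<nu>. Split into e^(i pi
  \<nu>) and e^(-i pi \<nu>), it moves into the exponent, giving a = \<plusminus>i pi - x. This is
  where (i pi - x)^n comes from, and it replaces a Leibniz sum over derivatives of the sine.\<close>

lemma norm_exp_partial_sum_le:
  fixes z :: complex
  shows "norm (\<Sum>k<n. z ^ k / fact k) \<le> exp (norm z)"
proof -
  have "norm (\<Sum>k<n. z ^ k / fact k) \<le> (\<Sum>k<n. norm z ^ k /\<^sub>R fact k)"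
    by (rule order_trans[OF norm_sum]) (simp add: norm_divide norm_power field_simps)
  also have "\<dots> \<le> (\<Sum>k. norm z ^ k /\<^sub>R fact k)"
    by (rule sum_le_suminf) (auto intro: summable_exp)
  finally show ?thesis by (simp add: exp_def)
qed

lemma power_le_fact_mult_exp:
  fixes x :: real
  assumes "x \<ge> 0"
  shows "x ^ n \<le> fact n * exp x"
proof -
  have "(\<Sum>k\<in>{n}. x ^ k /\<^sub>R fact k) \<le> (\<Sum>k. x ^ k /\<^sub>R fact k)"
    by (rule sum_le_suminf) (use assms in \<open>auto intro: summable_exp\<close>)
  then have "x ^ n / fact n \<le> exp x" by (simp add: exp_def divide_inverse mult.commute)
  then show ?thesis by (simp add: field_simps)
qed

lemma integrable_mult_exp:
  fixes h b :: "'a \<Rightarrow> complex"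
  assumes [measurable]: "h \<in> borel_measurable M" "b \<in> borel_measurable M"
    and int: "integrable M (\<lambda>x. norm (h x) * exp (norm (b x)))"
  shows "integrable M (\<lambda>x. h x * exp (b x))"
proof (rule Bochner_Integration.integrable_bound[OF int])
  have "norm (h x * exp (b x)) \<le> norm (norm (h x) * exp (norm (b x)))" for x
    by (simp add: norm_mult mult_left_mono complex_Re_le_cmod)
  then show "AE x in M. norm (h x * exp (b x)) \<le> norm (norm (h x) * exp (norm (b x)))" by simp
qed simp

lemma integrable_mult_power:
  fixes h b :: "'a \<Rightarrow> complex"
  assumes [measurable]: "h \<in> borel_measurable M" "b \<in> borel_measurable M"
    and int: "integrable M (\<lambda>x. norm (h x) * exp (norm (b x)))"
  shows "integrable M (\<lambda>x. h x * b x ^ k)"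
proof (rule Bochner_Integration.integrable_bound)
  show "integrable M (\<lambda>x. fact k * (norm (h x) * exp (norm (b x))))"
    by (intro integrable_mult_right int)
  have "norm (h x * b x ^ k) \<le> norm (fact k * (norm (h x) * exp (norm (b x))))" for x
    using mult_left_mono[OF power_le_fact_mult_exp[of "norm (b x)" k], of "norm (h x)"]
    by (simp add: norm_mult norm_power mult_ac)
  then show "AE x in M. norm (h x * b x ^ k) \<le> norm (fact k * (norm (h x) * exp (norm (b x))))"
    by simp
qed simp

text \<open>The partial sums of the exponential series of \<open>b x\<close> are bounded by
  \<open>exp (norm (b x))\<close>, so the integrable function of the third assumption dominates them
  all, and dominated convergence exchanges sum and integral.\<close>

lemma integral_exp_sums:
  fixes h b :: "'a \<Rightarrow> complex"
  assumes [measurable]: "h \<in> borel_measurable M" "b \<in> borel_measurable M"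
    and int: "integrable M (\<lambda>x. norm (h x) * exp (norm (b x)))"
  shows "(\<lambda>k. (\<integral>x. h x * b x ^ k \<partial>M) / fact k) sums (\<integral>x. h x * exp (b x) \<partial>M)"
proof -
  have "(\<lambda>n. \<integral>x. h x * (\<Sum>k<n. b x ^ k / fact k) \<partial>M) \<longlonglongrightarrow> (\<integral>x. h x * exp (b x) \<partial>M)"
  proof (rule integral_dominated_convergence[OF _ _ int])
    have "(\<lambda>n. \<Sum>k<n. b x ^ k / fact k) \<longlonglongrightarrow> exp (b x)" for x
      using exp_converges[of "b x"] by (simp add: sums_def scaleR_conv_of_real field_simps)
    then show "AE x in M. (\<lambda>n. h x * (\<Sum>k<n. b x ^ k / fact k)) \<longlonglongrightarrow> h x * exp (b x)"
      by (auto intro!: tendsto_mult_left)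
    show "AE x in M. norm (h x * (\<Sum>k<n. b x ^ k / fact k)) \<le> norm (h x) * exp (norm (b x))" for n
      by (auto simp: norm_mult intro!: mult_left_mono norm_exp_partial_sum_le)
  qed measurable
  also have "(\<lambda>n. \<integral>x. h x * (\<Sum>k<n. b x ^ k / fact k) \<partial>M) =
      (\<lambda>n. \<Sum>k<n. (\<integral>x. h x * b x ^ k \<partial>M) / fact k)"
  proof
    fix n
    have "(\<integral>x. h x * (\<Sum>k<n. b x ^ k / fact k) \<partial>M) =
        (\<integral>x. (\<Sum>k<n. h x * b x ^ k / fact k) \<partial>M)"
      by (simp add: sum_distrib_left)
    also have "\<dots> = (\<Sum>k<n. \<integral>x. h x * b x ^ k / fact k \<partial>M)"
      by (intro Bochner_Integration.integral_sum integrable_divide_zero integrable_mult_power assms)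
    finally show "(\<integral>x. h x * (\<Sum>k<n. b x ^ k / fact k) \<partial>M) =
      (\<Sum>k<n. (\<integral>x. h x * b x ^ k \<partial>M) / fact k)" by simp
  qed
  finally show ?thesis by (simp add: sums_def)
qed

lemma integrable_norm_mult_exp_mono:
  fixes h a :: "'a \<Rightarrow> complex"
  assumes [measurable]: "h \<in> borel_measurable M" "a \<in> borel_measurable M"
    and int: "integrable M (\<lambda>x. norm (h x) * exp (R * norm (a x)))" and "S \<le> R"
  shows "integrable M (\<lambda>x. norm (h x) * exp (S * norm (a x)))"
proof (rule Bochner_Integration.integrable_bound[OF int])
  show "AE x in M. norm (norm (h x) * exp (S * norm (a x))) \<le> norm (norm (h x) * exp (R * norm (a x)))"
    using \<open>S \<le> R\<close> by (auto intro!: mult_left_mono mult_right_mono)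
qed simp

text \<open>A factor u = \<open>norm (a x)\<close> costs only an arbitrarily small part of the
  exponent: u \<le> exp ((R - S) u) / (R - S). This pays for the factor \<open>a\<close> that each
  differentiation brings down.\<close>

lemma integrable_norm_mult_mult_exp:
  fixes h a :: "'a \<Rightarrow> complex"
  assumes [measurable]: "h \<in> borel_measurable M" "a \<in> borel_measurable M"
    and int: "integrable M (\<lambda>x. norm (h x) * exp (R * norm (a x)))" and "S < R"
  shows "integrable M (\<lambda>x. norm (h x * a x) * exp (S * norm (a x)))"
proof (rule Bochner_Integration.integrable_bound)
  show "integrable M (\<lambda>x. 1 / (R - S) * (norm (h x) * exp (R * norm (a x))))"
    by (intro integrable_mult_right int)
  have "norm (a x) * exp (S * norm (a x)) \<le> 1 / (R - S) * exp (R * norm (a x))" for x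
  proof -
    have "(R - S) * norm (a x) \<le> exp ((R - S) * norm (a x))"
      using exp_ge_add_one_self[of "(R - S) * norm (a x)"] by linarith
    then have "(R - S) * norm (a x) * exp (S * norm (a x)) \<le>
        exp ((R - S) * norm (a x)) * exp (S * norm (a x))"
      by (intro mult_right_mono) auto
    also have "\<dots> = exp (R * norm (a x))" by (simp flip: exp_add add: algebra_simps)
    finally show ?thesis using \<open>S < R\<close> by (simp add: field_simps)
  qed
  from mult_left_mono[OF this, of "norm (h _)"]
  show "AE x in M. norm (norm (h x * a x) * exp (S * norm (a x)))
      \<le> norm (1 / (R - S) * (norm (h x) * exp (R * norm (a x))))"
    using \<open>S < R\<close> by (auto simp: norm_mult mult_ac abs_mult)
qed simp

text \<open>The integral is the power series whose coefficients \<open>c k\<close> are the moments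
  of \<open>a\<close> over k!. Its formal derivative \<open>diffs c\<close> is the corresponding
  series for the weight \<open>h x * a x\<close>, so termwise differentiation inside the disc gives
  the claim. A single \<open>R\<close> is assumed, so the lemma also covers weights with limited
  exponential decay.\<close>

lemma has_field_derivative_integral_exp:
  fixes h a :: "'a \<Rightarrow> complex"
  assumes [measurable]: "h \<in> borel_measurable M" "a \<in> borel_measurable M"
    and int: "integrable M (\<lambda>x. norm (h x) * exp (R * norm (a x)))" and z: "norm z < R"
  shows "((\<lambda>z. \<integral>x. h x * exp (a x * z) \<partial>M) has_field_derivative
           (\<integral>x. h x * a x * exp (a x * z) \<partial>M)) (at z)"
proof -
  define c where "c k = (\<integral>x. h x * a x ^ k \<partial>M) / fact k" for k
  have F: "(\<lambda>k. c k * w ^ k) sums (\<integral>x. h x * exp (a x * w) \<partial>M)" if "norm w \<le> R" for w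
  proof -
    have "integrable M (\<lambda>x. norm (h x) * exp (norm (a x * w)))"
      using integrable_norm_mult_exp_mono[OF assms(1-3) that] by (simp add: norm_mult mult_ac)
    then have "(\<lambda>k. (\<integral>x. h x * (a x * w) ^ k \<partial>M) / fact k) sums (\<integral>x. h x * exp (a x * w) \<partial>M)"
      by (intro integral_exp_sums) auto
    also have "(\<lambda>k. (\<integral>x. h x * (a x * w) ^ k \<partial>M) / fact k) = (\<lambda>k. c k * w ^ k)"
      by (simp add: c_def power_mult_distrib flip: mult.assoc)
    finally show ?thesis .
  qed
  have F': "(\<lambda>k. diffs c k * z ^ k) sums (\<integral>x. h x * a x * exp (a x * z) \<partial>M)"
  proof -
    have "integrable M (\<lambda>x. norm (h x * a x) * exp (norm (a x * z)))"
      using integrable_norm_mult_mult_exp[OF assms(1-3) z] by (simp add: norm_mult mult_ac)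
    then have "(\<lambda>k. (\<integral>x. (h x * a x) * (a x * z) ^ k \<partial>M) / fact k) sums
        (\<integral>x. (h x * a x) * exp (a x * z) \<partial>M)"
      by (intro integral_exp_sums) auto
    also have "(\<lambda>k. (\<integral>x. (h x * a x) * (a x * z) ^ k \<partial>M) / fact k) = (\<lambda>k. diffs c k * z ^ k)"
    proof
      fix k
      have "(\<integral>x. (h x * a x) * (a x * z) ^ k \<partial>M) = (\<integral>x. h x * a x ^ Suc k * z ^ k \<partial>M)"
        by (rule Bochner_Integration.integral_cong) (auto simp: power_mult_distrib mult_ac)
      also have "\<dots> = c (Suc k) * fact (Suc k) * z ^ k"
        unfolding c_def by (simp del: power_Suc fact_Suc)
      finally show "(\<integral>x. (h x * a x) * (a x * z) ^ k \<partial>M) / fact k = diffs c k * z ^ k"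
        by (simp add: diffs_def)
    qed
    finally show ?thesis .
  qed
  have "R > 0" using z norm_ge_zero[of z] by linarith
  \<comment> \<open>\<open>F\<close> includes the boundary \<open>norm w = R\<close>, so convergence
    at the point \<open>R\<close> itself yields differentiability in the whole open disc.\<close>
  have "((\<lambda>w. \<Sum>k. c k * w ^ k) has_field_derivative (\<Sum>k. diffs c k * z ^ k)) (at z)"
    using sums_summable[OF F[of "of_real R"]] z \<open>R > 0\<close>
    by (intro termdiffs_strong[where K = "of_real R"]) auto
  then show ?thesis
    unfolding sums_unique[OF F', symmetric]
  proof (rule has_field_derivative_transform_within_open)
    show "z \<in> ball 0 R" using z by simp
    show "(\<Sum>k. c k * w ^ k) = (\<integral>x. h x * exp (a x * w) \<partial>M)" if "w \<in> ball 0 R" for w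
      using F[of w] that by (simp add: sums_iff)
  qed simp
qed

text \<open>Asking for every \<open>R\<close> makes the integral entire in its parameter and makes
  the condition stable under replacing \<open>h\<close> by \<open>h * a\<close>, so that derivatives
  of all orders follow by iteration.\<close>

definition exp_moments :: "'a measure \<Rightarrow> ('a \<Rightarrow> complex) \<Rightarrow> ('a \<Rightarrow> complex) \<Rightarrow> bool" where
  "exp_moments M h a \<longleftrightarrow> h \<in> borel_measurable M \<and> a \<in> borel_measurable M \<and>
     (\<forall>R. integrable M (\<lambda>x. norm (h x) * exp (R * norm (a x))))"

lemma exp_moments_sums:
  assumes "exp_moments M h b"
  shows "(\<lambda>k. (\<integral>x. h x * b x ^ k \<partial>M) / fact k) sums (\<integral>x. h x * exp (b x) \<partial>M)"
  using assms unfolding exp_moments_def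
  by (intro integral_exp_sums) (auto dest: spec[of _ 1])

lemma exp_moments_mult_power:
  assumes "exp_moments M h a"
  shows "exp_moments M (\<lambda>x. h x * a x ^ n) a"
proof (induction n)
  case 0
  then show ?case using assms by simp
next
  case (Suc n)
  then have [measurable]: "(\<lambda>x. h x * a x ^ n) \<in> borel_measurable M" "a \<in> borel_measurable M"
    and int: "integrable M (\<lambda>x. norm (h x * a x ^ n) * exp (R * norm (a x)))" for R
    by (auto simp: exp_moments_def)
  have "integrable M (\<lambda>x. norm (h x * a x ^ n * a x) * exp (R * norm (a x)))" for R
    by (rule integrable_norm_mult_mult_exp[OF _ _ int[of "R + 1"]]) auto
  moreover have "(\<lambda>x. h x * a x ^ n * a x) \<in> borel_measurable M" by measurable
  ultimately show ?case by (simp add: exp_moments_def mult_ac)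
qed

lemma integrable_exp_moments:
  assumes "exp_moments M h a"
  shows "integrable M (\<lambda>x. h x * a x ^ n * exp (a x * z))"
proof -
  have *: "exp_moments M (\<lambda>x. h x * a x ^ n) a" using assms by (rule exp_moments_mult_power)
  then have "integrable M (\<lambda>x. norm (h x * a x ^ n) * exp (norm z * norm (a x)))"
    unfolding exp_moments_def by blast
  with * show ?thesis
    by (intro integrable_mult_exp) (auto simp: exp_moments_def norm_mult mult_ac)
qed

lemma DERIV_exp_moments:
  assumes "exp_moments M h a"
  shows "((\<lambda>z. \<integral>x. h x * a x ^ n * exp (a x * z) \<partial>M) has_field_derivative
           (\<integral>x. h x * a x ^ Suc n * exp (a x * z) \<partial>M)) (at z)"
proof -
  have *: "exp_moments M (\<lambda>x. h x * a x ^ n) a" using assms by (rule exp_moments_mult_power)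
  then have "integrable M (\<lambda>x. norm (h x * a x ^ n) * exp ((norm z + 1) * norm (a x)))"
    unfolding exp_moments_def by blast
  with * have "((\<lambda>z. \<integral>x. h x * a x ^ n * exp (a x * z) \<partial>M) has_field_derivative
           (\<integral>x. h x * a x ^ n * a x * exp (a x * z) \<partial>M)) (at z)"
    by (intro has_field_derivative_integral_exp[where R = "norm z + 1"]) (auto simp: exp_moments_def)
  then show ?thesis by (simp add: mult_ac)
qed

lemma holomorphic_exp_moments:
  assumes "exp_moments M h a"
  shows "(\<lambda>z. \<integral>x. h x * exp (a x * z) \<partial>M) holomorphic_on A"
  using DERIV_exp_moments[OF assms, of 0]
  by (auto simp: holomorphic_on_def field_differentiable_def intro: has_field_derivative_at_within)

section \<open>Moment conditions on compact intervals and on the half-line\<close>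

lemma integrable_lebesgue_on_iff_absolutely_integrable:
  fixes f :: "'a::euclidean_space \<Rightarrow> 'b::euclidean_space"
  assumes "S \<in> sets lebesgue"
  shows "integrable (lebesgue_on S) f \<longleftrightarrow> f absolutely_integrable_on S"
  using assms by (simp add: integrable_restrict_space set_integrable_def)

lemma exp_moments_interval:
  fixes h a :: "real \<Rightarrow> complex"
  assumes "continuous_on {c..d} h" "continuous_on {c..d} a"
  shows "exp_moments (lebesgue_on {c..d}) h a"
  unfolding exp_moments_def using assms
  by (auto simp: integrable_lebesgue_on_iff_absolutely_integrable
        intro!: continuous_imp_measurable_on_sets_lebesgue absolutely_integrable_continuous_real
          continuous_intros)

text \<open>Doubly exponential decay exp (- c e^x) beats exp (D x) for every D: since e^x \<ge>
  x^2/2, completing the square bounds D x - c e^x by D^2 / (2 c).\<close>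

lemma exp_moments_halfline:
  fixes h a :: "real \<Rightarrow> complex"
  assumes cont: "continuous_on {0..} h" "continuous_on {0..} a"
    and c: "c > 0" and h: "\<And>x. x \<ge> 0 \<Longrightarrow> norm (h x) \<le> C * exp (B * x - c * exp x)"
    and a: "\<And>x. x \<ge> 0 \<Longrightarrow> norm (a x) \<le> A + x"
  shows "exp_moments (lebesgue_on {0..}) h a"
proof -
  have meas: "h \<in> borel_measurable (lebesgue_on {0..})" "a \<in> borel_measurable (lebesgue_on {0..})"
    using cont by (auto intro!: continuous_imp_measurable_on_sets_lebesgue)
  have C: "C \<ge> 0"
  proof -
    have "0 \<le> C * exp (B * 0 - c * exp 0)" using h[of 0] norm_ge_zero[of "h 0"] by linarith
    then show ?thesis by (simp add: zero_le_mult_iff)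
  qed
  have "integrable (lebesgue_on {0..}) (\<lambda>x. norm (h x) * exp (R * norm (a x)))" for R
  proof -
    \<comment> \<open>\<open>B\<close> comes from the bound on \<open>h\<close>,
      \<open>\<bar>R\<bar>\<close> from the bound on \<open>a\<close>; the extra 1 leaves a factor
      exp (- x), the integrable majorant.\<close>
    define D where "D = B + \<bar>R\<bar> + 1"
    define K where "K = C * exp (\<bar>R\<bar> * A + D\<^sup>2 / (2 * c))"
    have "(\<lambda>x. exp (- 1 * x) :: real) absolutely_integrable_on {0..}"
      by (intro nonnegative_absolutely_integrable_1 integrable_on_exp_minus_to_infinity) auto
    then have int: "integrable (lebesgue_on {0..}) (\<lambda>x. K * exp (- x))"
      by (intro integrable_mult_right) (simp add: integrable_lebesgue_on_iff_absolutely_integrable)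
    show ?thesis
    proof (rule Bochner_Integration.integrable_bound[OF int])
      show "(\<lambda>x. norm (h x) * exp (R * norm (a x))) \<in> borel_measurable (lebesgue_on {0..})"
        using meas by measurable
      have "norm (h x) * exp (R * norm (a x)) \<le> K * exp (- x)" if x: "x \<ge> 0" for x
      proof -
        have sq: "D * x \<le> D\<^sup>2 / (2 * c) + c * (x\<^sup>2 / 2)"
        proof -
          have "0 \<le> (D - c * x)\<^sup>2 / (2 * c)" using c by simp
          also have "\<dots> = D\<^sup>2 / (2 * c) + c * (x\<^sup>2 / 2) - D * x"
            using c by (simp add: field_simps power2_eq_square)
          finally show ?thesis by simp
        qed
        have "x\<^sup>2 / 2 \<le> exp x" using exp_lower_Taylor_quadratic[OF x] x by linarith
        then have "c * (x\<^sup>2 / 2) \<le> c * exp x" using c by simp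
        with sq have le: "D * x - c * exp x \<le> D\<^sup>2 / (2 * c)" by linarith
        have "R * norm (a x) \<le> \<bar>R\<bar> * norm (a x)" by (intro mult_right_mono) auto
        also have "\<dots> \<le> \<bar>R\<bar> * (A + x)" using a[OF x] by (intro mult_left_mono) auto
        finally have "norm (h x) * exp (R * norm (a x)) \<le>
            C * exp (B * x - c * exp x) * exp (\<bar>R\<bar> * (A + x))"
          using h[OF x] C by (intro mult_mono) auto
        also have "\<dots> = C * exp (\<bar>R\<bar> * A + (D * x - c * exp x) - x)"
          by (simp add: D_def algebra_simps flip: exp_add)
        also have "\<dots> \<le> C * exp (\<bar>R\<bar> * A + D\<^sup>2 / (2 * c) - x)"
          using le C by (intro mult_left_mono) auto
        also have "\<dots> = K * exp (- x)" by (simp add: K_def flip: exp_add)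
        finally show ?thesis .
      qed
      then have "norm (norm (h x) * exp (R * norm (a x))) \<le> norm (K * exp (- x))" if "x \<ge> 0" for x
        using that C by (simp add: K_def)
      then show "AE x in lebesgue_on {0..}. norm (norm (h x) * exp (R * norm (a x))) \<le> norm (K * exp (- x))"
        by (intro AE_I2) (auto simp: space_restrict_space)
    qed
  qed
  with meas show ?thesis by (simp add: exp_moments_def)
qed

section \<open>Hankel's integral\<close>

text \<open>Supplies the accumulation point for both uses of the identity theorem, where agreement
  is known only on a real half-line.\<close>

lemma islimpt_of_real_image:
  fixes S :: "real set"
  assumes "connected S" "x \<in> S" "y \<in> S" "x \<noteq> y"
  shows "complex_of_real x islimpt of_real ` S"
proof (rule connected_imp_perfect)
  show "connected (complex_of_real ` S)"
    by (intro connected_continuous_image continuous_intros assms)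
  show "complex_of_real ` S \<noteq> {a}" for a using assms
    by (metis image_eqI of_real_eq_iff singletonD)
qed (use assms in auto)

text \<open>Euler's integral is cut at u = r and the tail is rewritten by u = r e^x, under which
  u^(\<sigma>-1) du becomes r^\<sigma> e^(\<sigma> x) dx. In this form the tail is the ray integral
  at order -\<sigma>.\<close>

lemma Gamma_eq_integrals:
  fixes \<sigma> r :: real
  assumes \<sigma>: "\<sigma> > 0" and r: "r > 0"
  shows "Gamma \<sigma> = (\<integral>u. u powr (\<sigma> - 1) * exp (- u) \<partial>lebesgue_on {0..r}) +
           r powr \<sigma> * (\<integral>x. exp (\<sigma> * x - r * exp x) \<partial>lebesgue_on {0..})"
proof -
  define f where "f u = u powr (\<sigma> - 1) * exp (- u)" for u
  have f: "(f has_integral Gamma \<sigma>) {0..}"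
    using Gamma_integral_real[OF \<sigma>] by (simp add: f_def[abs_def] exp_minus divide_inverse)
  have abs: "f absolutely_integrable_on {0..}"
    using f by (intro nonnegative_absolutely_integrable_1) (auto simp: f_def)
  have sub: "f absolutely_integrable_on S" if "S \<in> sets lebesgue" "S \<subseteq> {0..}" for S
    using abs that by (rule set_integrable_subset)
  have P: "(f has_integral (\<integral>u. f u \<partial>lebesgue_on {0..r})) {0..r}"
    using sub[of "{0..r}"]
    by (intro has_integral_integral_lebesgue_on)
       (auto simp: integrable_lebesgue_on_iff_absolutely_integrable)
  have Q: "(f has_integral integral {r..} f) {r..}"
    using sub[of "{r..}"] r by (auto simp: set_lebesgue_integral_eq_integral)
  have "{0..r} \<inter> {r..} = {r}" using r by auto
  then have "(f has_integral ((\<integral>u. f u \<partial>lebesgue_on {0..r}) + integral {r..} f)) ({0..r} \<union> {r..})"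
    by (intro has_integral_Un P Q) auto
  moreover have "{0..r} \<union> {r..} = {0..}" using r by auto
  ultimately have split: "Gamma \<sigma> = (\<integral>u. f u \<partial>lebesgue_on {0..r}) + integral {r..} f"
    using f has_integral_unique by metis
  have img: "(\<lambda>x. r * exp x) ` {0..} = {r..}"
  proof safe
    fix u assume "u \<ge> r"
    then show "u \<in> (\<lambda>x. r * exp x) ` {0..}"
      using r by (intro image_eqI[of _ _ "ln (u / r)"]) auto
  qed (use r in auto)
  have "f absolutely_integrable_on (\<lambda>x. r * exp x) ` {0..} \<and>
      integral ((\<lambda>x. r * exp x) ` {0..}) f = integral {r..} f"
    unfolding img using sub[of "{r..}"] r by auto
  then have cv: "(\<lambda>x. \<bar>r * exp x\<bar> * f (r * exp x)) absolutely_integrable_on {0..} \<and>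
      integral {0..} (\<lambda>x. \<bar>r * exp x\<bar> * f (r * exp x)) = integral {r..} f"
    by (subst has_absolute_integral_change_of_variables_1')
       (use r in \<open>auto intro!: derivative_eq_intros inj_onI\<close>)
  have eq: "\<bar>r * exp x\<bar> * f (r * exp x) = r powr \<sigma> * exp (\<sigma> * x - r * exp x)" for x
  proof -
    have "r * exp x = (r * exp x) powr 1" using r by simp
    then have "(r * exp x) * (r * exp x) powr (\<sigma> - 1) = (r * exp x) powr \<sigma>"
      by (metis powr_add add.commute diff_add_cancel)
    also have "\<dots> = r powr \<sigma> * exp (\<sigma> * x)" using r by (simp add: powr_mult exp_powr_real mult.commute)
    finally show ?thesis
      using r by (simp add: f_def exp_diff exp_minus divide_inverse mult.assoc [symmetric])
  qed
  have "integral {r..} f = (\<integral>x. r powr \<sigma> * exp (\<sigma> * x - r * exp x) \<partial>lebesgue_on {0..})"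
    using cv unfolding eq
    by (metis integrable_lebesgue_on_iff_absolutely_integrable lebesgue_integral_eq_integral lborelD
        atLeast_borel sets_completionI_sets sets_lborel)
  then show ?thesis using split by (simp add: f_def)
qed

text \<open>The factor e^(-u) is expanded and integrated termwise against u^(\<sigma>-1); on [0, r]
  the majorant is u^(\<sigma>-1) e^r. The result is to be matched with the series of the two
  arcs.\<close>

lemma incomplete_Gamma_sums:
  fixes \<sigma> r :: real
  assumes \<sigma>: "\<sigma> > 0" and r: "r > 0"
  shows "(\<lambda>m. complex_of_real ((- 1) ^ m * r powr (\<sigma> + m) / (fact m * (\<sigma> + m)))) sums
           of_real (\<integral>u. u powr (\<sigma> - 1) * exp (- u) \<partial>lebesgue_on {0..r})"
proof -
  let ?M = "lebesgue_on {0..r}"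
  have pw: "((\<lambda>u. u powr (\<sigma> + real m - 1)) has_integral r powr (\<sigma> + m) / (\<sigma> + m)) {0..r}" for m :: nat
    using has_integral_powr_from_0[of "\<sigma> + real m - 1" r] \<sigma> r by (simp add: add_pos_nonneg)
  have int: "integrable ?M (\<lambda>u. u powr (\<sigma> + real m - 1))" for m :: nat
    using pw[of m] by (auto simp: integrable_lebesgue_on_iff_absolutely_integrable
        intro!: nonnegative_absolutely_integrable_1)
  from int[of 0] have int0: "integrable ?M (\<lambda>u. u powr (\<sigma> - 1))" by simp
  have [measurable]: "(\<lambda>u. u) \<in> borel_measurable ?M"
    by (intro continuous_imp_measurable_on_sets_lebesgue continuous_intros) auto
  have "integrable ?M (\<lambda>u. norm (complex_of_real (u powr (\<sigma> - 1))) * exp (norm (- complex_of_real u)))"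
  proof (rule Bochner_Integration.integrable_bound)
    show "integrable ?M (\<lambda>u. u powr (\<sigma> - 1) * exp r)" using int0 by simp
    show "AE u in ?M. norm (norm (complex_of_real (u powr (\<sigma> - 1))) * exp (norm (- complex_of_real u)))
        \<le> norm (u powr (\<sigma> - 1) * exp r)"
      by (intro AE_I2) (auto simp: space_restrict_space intro!: mult_left_mono)
  qed measurable
  then have "(\<lambda>m. (\<integral>u. complex_of_real (u powr (\<sigma> - 1)) * (- complex_of_real u) ^ m \<partial>?M) / fact m)
      sums (\<integral>u. complex_of_real (u powr (\<sigma> - 1)) * exp (- complex_of_real u) \<partial>?M)"
    by (intro integral_exp_sums) measurable
  also have "(\<integral>u. complex_of_real (u powr (\<sigma> - 1)) * exp (- complex_of_real u) \<partial>?M) =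
      of_real (\<integral>u. u powr (\<sigma> - 1) * exp (- u) \<partial>?M)"
    by (simp flip: integral_complex_of_real exp_of_real)
  also have "(\<lambda>m. (\<integral>u. complex_of_real (u powr (\<sigma> - 1)) * (- complex_of_real u) ^ m \<partial>?M) / fact m) =
      (\<lambda>m. of_real ((- 1) ^ m * r powr (\<sigma> + m) / (fact m * (\<sigma> + m))))"
  proof
    fix m :: nat
    have "(\<integral>u. complex_of_real (u powr (\<sigma> - 1)) * (- complex_of_real u) ^ m \<partial>?M) =
        (\<integral>u. of_real ((- 1) ^ m * u powr (\<sigma> + real m - 1)) \<partial>?M)"
    proof (intro Bochner_Integration.integral_cong refl)
      fix u assume "u \<in> space ?M"
      then have "u \<ge> 0" by (simp add: space_restrict_space)
      \<comment> \<open>At \<open>u = 0\<close> both sides are 0 because \<open>0 powr a = 0\<close>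
        for every \<open>a\<close>; this covers \<open>m = 0\<close>, where
        \<open>0 ^ m = 1\<close>.\<close>
      then have "u powr (\<sigma> - 1) * u ^ m = u powr (\<sigma> + real m - 1)"
      proof (cases "u = 0")
        case False
        then show ?thesis using \<open>u \<ge> 0\<close>
          by (simp flip: powr_realpow powr_add add: algebra_simps)
      qed auto
      then show "complex_of_real (u powr (\<sigma> - 1)) * (- complex_of_real u) ^ m =
          of_real ((- 1) ^ m * u powr (\<sigma> + real m - 1))"
        by (metis (no_types, opaque_lifting) mult.left_commute of_real_minus of_real_mult of_real_power power_minus)
    qed
    also have "\<dots> = of_real ((- 1) ^ m * (\<integral>u. u powr (\<sigma> + real m - 1) \<partial>?M))"
      by (subst integral_complex_of_real) simp
    also have "(\<integral>u. u powr (\<sigma> + real m - 1) \<partial>?M) = r powr (\<sigma> + m) / (\<sigma> + m)"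
      using pw[of m] int[of m] by (simp add: lebesgue_integral_eq_integral integral_unique)
    finally show "(\<integral>u. complex_of_real (u powr (\<sigma> - 1)) * (- complex_of_real u) ^ m \<partial>?M) / fact m =
        of_real ((- 1) ^ m * r powr (\<sigma> + m) / (fact m * (\<sigma> + m)))"
      by simp
  qed
  finally show ?thesis .
qed

text \<open>With \<open>s = \<plusminus>1\<close>, the parametrisation \<open>r cis (s x)\<close> runs over the upper and lower half of the
  circle; \<open>ray_integral\<close> is the integral along the ray parametrised by \<open>- r exp x\<close>.\<close>

abbreviation arc_measure :: "real measure" where "arc_measure \<equiv> lebesgue_on {0..pi}"
abbreviation ray_measure :: "real measure" where "ray_measure \<equiv> lebesgue_on {0..}"

section \<open>Hankel's identity for two arcs and a ray\<close>

lemma integral_cos_arc: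
  fixes \<alpha> :: real
  assumes "\<alpha> \<noteq> 0"
  shows "(\<integral>x. exp (\<i> * of_real (\<alpha> * x)) \<partial>arc_measure) + (\<integral>x. exp (- \<i> * of_real (\<alpha> * x)) \<partial>arc_measure)
           = of_real (2 * sin (\<alpha> * pi) / \<alpha>)"
proof -
  have "((\<lambda>x. 2 * cos (\<alpha> * x)) has_integral (2 * sin (\<alpha> * pi) / \<alpha> - 2 * sin (\<alpha> * 0) / \<alpha>)) {0..pi}"
    by (rule fundamental_theorem_of_calculus)
       (use assms in \<open>auto intro!: derivative_eq_intros simp flip: has_real_derivative_iff_has_vector_derivative\<close>)
  then have hi: "((\<lambda>x. 2 * cos (\<alpha> * x)) has_integral (2 * sin (\<alpha> * pi) / \<alpha>)) {0..pi}" by simp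
  have int: "integrable arc_measure f" if "continuous_on {0..pi} f" for f :: "real \<Rightarrow> 'b::euclidean_space"
    using that by (auto simp: integrable_lebesgue_on_iff_absolutely_integrable
        intro!: absolutely_integrable_continuous_real)
  have "(\<integral>x. exp (\<i> * of_real (\<alpha> * x)) \<partial>arc_measure) + (\<integral>x. exp (- \<i> * of_real (\<alpha> * x)) \<partial>arc_measure)
      = (\<integral>x. exp (\<i> * of_real (\<alpha> * x)) + exp (- \<i> * of_real (\<alpha> * x)) \<partial>arc_measure)"
    by (intro Bochner_Integration.integral_add [symmetric] int continuous_intros)
  also have "\<dots> = (\<integral>x. of_real (2 * cos (\<alpha> * x)) \<partial>arc_measure)"
    by (intro Bochner_Integration.integral_cong refl)
       (simp add: cos_exp_eq flip: cos_of_real)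
  also have "\<dots> = of_real (\<integral>x. 2 * cos (\<alpha> * x) \<partial>arc_measure)" by (rule integral_complex_of_real)
  also have "(\<integral>x. 2 * cos (\<alpha> * x) \<partial>arc_measure) = 2 * sin (\<alpha> * pi) / \<alpha>"
    unfolding integral_unique[OF hi, symmetric]
    by (intro lebesgue_integral_eq_integral int continuous_intros) auto
  finally show ?thesis .
qed

definition arc_integral :: "real \<Rightarrow> real \<Rightarrow> complex \<Rightarrow> complex" where
  "arc_integral r s \<mu> =
     (\<integral>x. exp (of_real r * cis (s * x)) * exp (- \<i> * of_real (s * x) * \<mu>) \<partial>arc_measure)"

definition ray_integral :: "real \<Rightarrow> complex \<Rightarrow> complex" where
  "ray_integral r \<mu> = (\<integral>x. of_real (exp (- r * exp x)) * exp (- of_real x * \<mu>) \<partial>ray_measure)"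

lemma arc_moments:
  "exp_moments arc_measure (\<lambda>x. exp (of_real r * cis (s * x))) (\<lambda>x. - \<i> * of_real (s * x))"
  by (rule exp_moments_interval) (intro continuous_intros)+

lemma ray_moments:
  assumes "r > 0"
  shows "exp_moments ray_measure (\<lambda>x. of_real (exp (- r * exp x))) (\<lambda>x. - of_real x)"
  by (rule exp_moments_halfline[where c = r and C = 1 and B = 0 and A = 0])
     (use assms in \<open>auto intro!: continuous_intros\<close>)

text \<open>The m-th power of r cis (s x) raises the frequency from \<sigma> to \<sigma> + m. The
  two arcs together integrate 2 cos ((\<sigma> + m) x), and sin ((\<sigma> + m) pi) = (-1)^m sin
  (\<sigma> pi) lets the sine leave the sum and turns r^m into (-r)^m.\<close>

lemma arc_integral_sums:
  assumes \<sigma>: "\<sigma> > 0"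
  shows "(\<lambda>m. complex_of_real (2 * sin (\<sigma> * pi) * ((- r) ^ m / (fact m * (\<sigma> + m))))) sums
           (arc_integral r 1 (- of_real \<sigma>) + arc_integral r (-1) (- of_real \<sigma>))"
proof -
  define I where "I s m = (\<integral>x. exp (\<i> * of_real (s * ((\<sigma> + real m) * x))) \<partial>arc_measure)" for s m
  have "(\<lambda>m. of_real (r ^ m / fact m) * I s m) sums arc_integral r s (- of_real \<sigma>)" for s
  proof -
    \<comment> \<open>The roles are exchanged compared with \<open>arc_moments\<close>: here the
      factor containing \<sigma> is the weight and \<open>r cis (s x)\<close> is the exponent to be
      expanded.\<close>
    have "exp_moments arc_measure (\<lambda>x. exp (\<i> * of_real (s * x) * of_real \<sigma>)) (\<lambda>x. of_real r * cis (s * x))"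
      by (rule exp_moments_interval) (intro continuous_intros)+
    then have "(\<lambda>m. (\<integral>x. exp (\<i> * of_real (s * x) * of_real \<sigma>) * (of_real r * cis (s * x)) ^ m \<partial>arc_measure) / fact m)
        sums (\<integral>x. exp (\<i> * of_real (s * x) * of_real \<sigma>) * exp (of_real r * cis (s * x)) \<partial>arc_measure)"
      by (rule exp_moments_sums)
    moreover have "(\<integral>x. exp (\<i> * of_real (s * x) * of_real \<sigma>) * (of_real r * cis (s * x)) ^ m \<partial>arc_measure) / fact m
        = of_real (r ^ m / fact m) * I s m" for m
    proof -
      have "(\<integral>x. exp (\<i> * of_real (s * x) * of_real \<sigma>) * (of_real r * cis (s * x)) ^ m \<partial>arc_measure) =
          (\<integral>x. of_real r ^ m * exp (\<i> * of_real (s * ((\<sigma> + real m) * x))) \<partial>arc_measure)"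
        by (intro Bochner_Integration.integral_cong refl)
           (simp add: power_mult_distrib cis_conv_exp algebra_simps flip: exp_of_nat_mult exp_add)
      then show ?thesis by (simp add: I_def)
    qed
    ultimately show ?thesis by (simp add: arc_integral_def mult.commute)
  qed
  note this[of 1] this[of "-1"]
  then have "(\<lambda>m. of_real (r ^ m / fact m) * (I 1 m + I (-1) m)) sums
      (arc_integral r 1 (- of_real \<sigma>) + arc_integral r (-1) (- of_real \<sigma>))"
    unfolding distrib_left by (rule sums_add)
  moreover have "of_real (r ^ m / fact m) * (I 1 m + I (-1) m) =
      complex_of_real (2 * sin (\<sigma> * pi) * ((- r) ^ m / (fact m * (\<sigma> + m))))" for m :: nat
  proof -
    have "\<sigma> + real m \<noteq> 0" using \<sigma> by linarith
    from integral_cos_arc[OF this]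
    have "I 1 m + I (-1) m = of_real (2 * sin ((\<sigma> + real m) * pi) / (\<sigma> + real m))"
      by (simp add: I_def)
    moreover have "sin ((\<sigma> + real m) * pi) = (-1) ^ m * sin (\<sigma> * pi)"
      by (simp add: distrib_right sin_add cos_npi sin_npi)
    ultimately have "of_real (r ^ m / fact m) * (I 1 m + I (-1) m) =
        complex_of_real (r ^ m / fact m * (2 * ((-1) ^ m * sin (\<sigma> * pi)) / (\<sigma> + real m)))"
      by (simp only: of_real_mult)
    also have "r ^ m / fact m * (2 * ((-1) ^ m * sin (\<sigma> * pi)) / (\<sigma> + real m)) =
        2 * sin (\<sigma> * pi) * ((- r) ^ m / (fact m * (\<sigma> + m)))"
      by (simp add: power_minus[of r])
    finally show ?thesis .
  qed
  ultimately show ?thesis by simp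
qed

text \<open>Multiplied by 2 sin (\<sigma> pi) r^(-\<sigma>), the series of the lower incomplete
  Gamma integral \<open>P\<close> agrees term by term with that of the two arcs. The ray gives the
  tail \<open>Q\<close>, and sin (pi \<mu>) = - sin (\<sigma> pi) makes the two contributions add
  up.\<close>

lemma Hankel_neg_real:
  assumes r: "r > 0" and \<sigma>: "\<sigma> > 0"
  defines "\<mu> \<equiv> - complex_of_real \<sigma>"
  shows "(arc_integral r 1 \<mu> + arc_integral r (-1) \<mu>) / (2 * of_real pi)
           - sin (of_real pi * \<mu>) / of_real pi * ray_integral r \<mu> = of_real r powr \<mu> * rGamma (\<mu> + 1)"
proof -
  define P where "P = (\<integral>u. u powr (\<sigma> - 1) * exp (- u) \<partial>lebesgue_on {0..r})"
  define Q where "Q = (\<integral>x. exp (\<sigma> * x - r * exp x) \<partial>ray_measure)"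
  have "(\<lambda>m. complex_of_real (2 * sin (\<sigma> * pi) * r powr - \<sigma>) *
      complex_of_real ((- 1) ^ m * r powr (\<sigma> + m) / (fact m * (\<sigma> + m)))) sums
      (complex_of_real (2 * sin (\<sigma> * pi) * r powr - \<sigma>) * of_real P)"
    unfolding P_def by (intro sums_mult incomplete_Gamma_sums r \<sigma>)
  also have "(\<lambda>m. complex_of_real (2 * sin (\<sigma> * pi) * r powr - \<sigma>) *
      complex_of_real ((- 1) ^ m * r powr (\<sigma> + m) / (fact m * (\<sigma> + m)))) =
      (\<lambda>m. complex_of_real (2 * sin (\<sigma> * pi) * ((- r) ^ m / (fact m * (\<sigma> + m)))))"
  proof
    fix m :: nat
    have "r powr (\<sigma> + m) = r powr \<sigma> * r ^ m" using r by (simp add: powr_add powr_realpow)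
    then have "2 * sin (\<sigma> * pi) * r powr - \<sigma> * ((- 1) ^ m * r powr (\<sigma> + m) / (fact m * (\<sigma> + m))) =
        2 * sin (\<sigma> * pi) * ((- r) ^ m / (fact m * (\<sigma> + m)))"
      using r by (simp add: power_minus[of r] powr_minus field_simps)
    then show "complex_of_real (2 * sin (\<sigma> * pi) * r powr - \<sigma>) *
      complex_of_real ((- 1) ^ m * r powr (\<sigma> + m) / (fact m * (\<sigma> + m))) =
      complex_of_real (2 * sin (\<sigma> * pi) * ((- r) ^ m / (fact m * (\<sigma> + m))))"
      by (simp only: of_real_mult [symmetric])
  qed
  finally have arc: "arc_integral r 1 \<mu> + arc_integral r (-1) \<mu> =
      of_real (2 * sin (\<sigma> * pi) * r powr - \<sigma> * P)"
    using sums_unique2[OF arc_integral_sums[OF \<sigma>]] unfolding \<mu>_def by simp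
  have ray: "ray_integral r \<mu> = of_real Q"
    unfolding ray_integral_def Q_def integral_complex_of_real [symmetric] \<mu>_def
    by (intro Bochner_Integration.integral_cong refl)
       (simp add: exp_diff exp_minus divide_inverse mult.commute flip: exp_of_real)
  have sin: "sin (of_real pi * \<mu>) = - of_real (sin (\<sigma> * pi))"
    by (simp add: \<mu>_def mult.commute flip: sin_of_real)
  have "(arc_integral r 1 \<mu> + arc_integral r (-1) \<mu>) / (2 * of_real pi)
      - sin (of_real pi * \<mu>) / of_real pi * ray_integral r \<mu> =
      of_real (sin (\<sigma> * pi) / pi * (r powr - \<sigma> * P + Q))"
    unfolding arc ray sin by (simp add: field_simps)
  \<comment> \<open>The dependence on the cut point \<open>r\<close> disappears here, up to the
    power r^(-\<sigma>): both pieces of Euler's integral are present.\<close>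
  also have "r powr - \<sigma> * P + Q = r powr - \<sigma> * Gamma \<sigma>"
    unfolding Gamma_eq_integrals[OF \<sigma> r] P_def Q_def using r by (simp add: powr_minus field_simps)
  also have "complex_of_real (sin (\<sigma> * pi) / pi * (r powr - \<sigma> * Gamma \<sigma>)) =
      of_real (r powr - \<sigma>) * (Gamma (of_real \<sigma>) * (sin (of_real pi * of_real \<sigma>) / of_real pi))"
    by (simp add: Gamma_complex_of_real mult_ac flip: sin_of_real)
  \<comment> \<open>Reflection formula, with 1 - \<sigma> = \<mu> + 1. The factor
    \<open>rGamma\<close> at \<sigma> then cancels against Gamma, \<sigma> > 0 being no
    pole.\<close>
  also have "sin (of_real pi * of_real \<sigma>) / of_real pi = rGamma (of_real \<sigma>) * rGamma (\<mu> + 1)"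
    unfolding rGamma_reflection_complex [symmetric] by (simp add: \<mu>_def)
  also have "Gamma (complex_of_real \<sigma>) * (rGamma (of_real \<sigma>) * rGamma (\<mu> + 1)) = rGamma (\<mu> + 1)"
  proof -
    have "rGamma (complex_of_real \<sigma>) \<noteq> 0"
      using \<sigma> by (auto simp: rGamma_eq_zero_iff of_real_in_nonpos_Ints_iff dest: nonpos_Ints_nonpos)
    then show ?thesis by (simp add: Gamma_def)
  qed
  also have "complex_of_real (r powr - \<sigma>) = of_real r powr \<mu>"
    using r by (simp add: \<mu>_def flip: powr_of_real)
  finally show ?thesis .
qed

text \<open>Hankel's integrand e^z z^(-\<mu>-1) dz becomes e^z z^(-\<mu>) dx on the ray, with a
  further factor \<plusminus>i on the arcs. The common factor r^(-\<mu>) of z^(-\<mu>) has been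
  taken to the other side, where it is \<open>of_real r powr \<mu>\<close>; the phases e^(-i pi
  \<mu>) and e^(i pi \<mu>) on the two sides of the cut combine to the sine. Both sides are entire
  in \<mu>.\<close>

theorem Hankel_rGamma:
  assumes r: "r > 0"
  shows "(arc_integral r 1 \<mu> + arc_integral r (-1) \<mu>) / (2 * of_real pi)
           - sin (of_real pi * \<mu>) / of_real pi * ray_integral r \<mu> = of_real r powr \<mu> * rGamma (\<mu> + 1)"
proof -
  define f where "f \<mu> = (arc_integral r 1 \<mu> + arc_integral r (-1) \<mu>) / (2 * of_real pi)
      - sin (of_real pi * \<mu>) / of_real pi * ray_integral r \<mu> - of_real r powr \<mu> * rGamma (\<mu> + 1)" for \<mu>
  have [holomorphic_intros]: "arc_integral r s holomorphic_on UNIV" for s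
    using holomorphic_exp_moments[OF arc_moments] by (simp add: arc_integral_def[abs_def])
  have [holomorphic_intros]: "ray_integral r holomorphic_on UNIV"
    using holomorphic_exp_moments[OF ray_moments[OF r]] by (simp add: ray_integral_def[abs_def])
  have "f \<mu> = 0"
  proof (rule analytic_continuation[where f = f and U = "of_real ` {..<0}"])
    show "f holomorphic_on UNIV"
      unfolding f_def using r by (intro holomorphic_intros) auto
    show "complex_of_real (-1) islimpt of_real ` {..<0}"
      by (rule islimpt_of_real_image[where y = "-2"]) auto
    show "f z = 0" if "z \<in> of_real ` {..<0}" for z
    proof -
      from that obtain x where "z = of_real x" "x < 0" by auto
      then show ?thesis using Hankel_neg_real[OF r, of "- x"] by (simp add: f_def)
    qed
  qed auto
  then show ?thesis by (simp add: f_def)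
qed

section \<open>Schlaefli's integral\<close>

lemma half_exp_le_cosh:
  fixes c x :: real
  assumes "c > 0"
  shows "c / 2 * exp x \<le> c * cosh x"
proof -
  have "exp x / 2 \<le> cosh x" by (simp add: cosh_field_def)
  from mult_left_mono[OF this, of c] assms show ?thesis by simp
qed

text \<open>The factor exp (r cis (- s x)) is expanded: its k-th power contributes e^(-i s k x),
  which raises the order from \<nu> to \<nu> + k. Unexpanded, it combines with exp (r cis (s x)) to
  e^(2 r cos x).\<close>

lemma arc_expansion:
  "(\<lambda>k. of_real (r ^ k / fact k) * arc_integral r s (\<nu> + of_nat k)) sums
     (\<integral>x. exp (of_real (2 * r) * of_real (cos x)) * exp (- \<i> * of_real (s * x) * \<nu>) \<partial>arc_measure)"
  if "s \<in> {1, - 1}"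
proof -
  let ?h = "\<lambda>x. exp (of_real r * cis (s * x)) * exp (- \<i> * of_real (s * x) * \<nu>)"
  have "exp_moments arc_measure ?h (\<lambda>x. of_real r * cis (- (s * x)))"
    by (rule exp_moments_interval) (intro continuous_intros)+
  then have "(\<lambda>k. (\<integral>x. ?h x * (of_real r * cis (- (s * x))) ^ k \<partial>arc_measure) / fact k)
      sums (\<integral>x. ?h x * exp (of_real r * cis (- (s * x))) \<partial>arc_measure)"
    by (rule exp_moments_sums)
  moreover have "?h x * exp (of_real r * cis (- (s * x))) =
      exp (of_real (2 * r) * of_real (cos x)) * exp (- \<i> * of_real (s * x) * \<nu>)" for x
  proof -
    have "of_real r * cis (s * x) + of_real r * cis (- (s * x)) = of_real (2 * r) * of_real (cos x)"
      using that by (auto simp: complex_eq_iff)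
    then have "exp (of_real r * cis (s * x)) * exp (of_real r * cis (- (s * x))) =
        exp (of_real (2 * r) * of_real (cos x))" by (simp only: exp_add [symmetric])
    then show ?thesis by (metis mult.assoc mult.commute)
  qed
  moreover have "(\<integral>x. ?h x * (of_real r * cis (- (s * x))) ^ k \<partial>arc_measure) / fact k =
      of_real (r ^ k / fact k) * arc_integral r s (\<nu> + of_nat k)" for k
  proof -
    have "cis (- (s * x)) ^ k = exp (- \<i> * of_real (s * x) * of_nat k)" for x
      by (simp add: cis_conv_exp mult_ac flip: exp_of_nat_mult)
    moreover have "exp (- \<i> * of_real (s * x) * (\<nu> + of_nat k)) =
        exp (- \<i> * of_real (s * x) * \<nu>) * exp (- \<i> * of_real (s * x) * of_nat k)" for x
      by (simp only: distrib_left exp_add)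
    ultimately have "(\<integral>x. ?h x * (of_real r * cis (- (s * x))) ^ k \<partial>arc_measure) =
        (\<integral>x. of_real r ^ k * (exp (of_real r * cis (s * x)) *
           exp (- \<i> * of_real (s * x) * (\<nu> + of_nat k))) \<partial>arc_measure)"
      by (simp only: power_mult_distrib mult_ac)
    then show ?thesis by (simp add: arc_integral_def)
  qed
  ultimately show ?thesis by (simp only:)
qed

text \<open>Counterpart of \<open>arc_expansion\<close> on the cut, where r^2/z is - r e^(-x). Its
  k-th power again raises the order by k, but brings a sign (-1)^k.\<close>

lemma ray_expansion:
  assumes r: "r > 0"
  shows "(\<lambda>k. of_real ((- r) ^ k / fact k) * ray_integral r (\<nu> + of_nat k)) sums
     (\<integral>x. exp (- of_real (2 * r) * of_real (cosh x)) * exp (- of_real x * \<nu>) \<partial>ray_measure)"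
proof -
  let ?h = "\<lambda>x. of_real (exp (- r * exp x)) * exp (- of_real x * \<nu>)"
  let ?b = "\<lambda>x. complex_of_real (- r * exp (- x))"
  have "exp_moments ray_measure ?h ?b"
  proof (rule exp_moments_halfline[OF _ _ r])
    show "norm (?h x) \<le> 1 * exp (- Re \<nu> * x - r * exp x)" for x
      by (simp add: norm_mult mult.commute flip: exp_add)
    \<comment> \<open>The exponent is in fact bounded by \<open>r\<close>; the form
      \<open>r + x\<close> is the one that the half-line criterion expects.\<close>
    show "norm (?b x) \<le> r + x" if "x \<ge> 0" for x
    proof -
      have "r * exp (- x) \<le> r * 1" using r that by (intro mult_left_mono) auto
      then have "r * exp (- x) \<le> r + x" using that by linarith
      then show ?thesis using r by (simp add: norm_mult del: of_real_mult of_real_minus)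
    qed
  qed (intro continuous_intros)+
  then have "(\<lambda>k. (\<integral>x. ?h x * ?b x ^ k \<partial>ray_measure) / fact k)
      sums (\<integral>x. ?h x * exp (?b x) \<partial>ray_measure)"
    by (rule exp_moments_sums)
  moreover have "?h x * exp (?b x) =
      exp (- of_real (2 * r) * of_real (cosh x)) * exp (- of_real x * \<nu>)" for x
  proof -
    have "- r * exp x + - r * exp (- x) = - (2 * r) * cosh x"
      by (simp add: cosh_field_def field_simps)
    then have "of_real (exp (- r * exp x)) * exp (?b x) = exp (complex_of_real (- (2 * r) * cosh x))"
      by (simp only: exp_of_real of_real_mult [symmetric] exp_add [symmetric])
    then show ?thesis by (simp add: mult_ac) 
  qed
  moreover have "(\<integral>x. ?h x * ?b x ^ k \<partial>ray_measure) / fact k =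
      of_real ((- r) ^ k / fact k) * ray_integral r (\<nu> + of_nat k)" for k
  proof -
    have "?b x ^ k = of_real (- r) ^ k * exp (- of_real x * of_nat k)" for x
    proof -
      have "?b x = of_real (- r) * exp (- of_real x)" by (simp flip: exp_of_real)
      then show ?thesis by (simp only: power_mult_distrib exp_of_nat_mult [symmetric] mult.commute)
    qed
    moreover have "exp (- of_real x * (\<nu> + of_nat k)) =
        exp (- of_real x * \<nu>) * exp (- of_real x * of_nat k)" for x
      by (simp only: distrib_left exp_add)
    ultimately have "(\<integral>x. ?h x * ?b x ^ k \<partial>ray_measure) =
        (\<integral>x. of_real (- r) ^ k * (of_real (exp (- r * exp x)) *
           exp (- of_real x * (\<nu> + of_nat k))) \<partial>ray_measure)"
      by (simp only: mult_ac)
    then show ?thesis by (simp add: ray_integral_def)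
  qed
  ultimately show ?thesis by (simp only:)
qed

text \<open>The factors \<open>1\<close> and \<open>- 1\<close> are kept so that both terms are instances of \<open>arc_expansion\<close>.\<close>

definition Schlaefli :: "complex \<Rightarrow> complex \<Rightarrow> complex" where
  "Schlaefli \<nu> t =
     ((\<integral>x. exp (t * of_real (cos x)) * exp (- \<i> * of_real (1 * x) * \<nu>) \<partial>arc_measure) +
      (\<integral>x. exp (t * of_real (cos x)) * exp (- \<i> * of_real (- 1 * x) * \<nu>) \<partial>arc_measure)) / (2 * of_real pi)
     - sin (of_real pi * \<nu>) / of_real pi *
      (\<integral>x. exp (- t * of_real (cosh x)) * exp (- of_real x * \<nu>) \<partial>ray_measure)"

text \<open>Hankel's identity at order \<nu> + k, multiplied by r^k / k!, is the k-th Bessel term at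
  t = 2 r, as r^k r^(\<nu>+k) = r^(2k+\<nu>). Summability of the Bessel series is obtained along
  with its value.\<close>

lemma bessel_I_sums_Schlaefli:
  assumes r: "r > 0"
  shows "(\<lambda>k. rGamma (of_nat k + \<nu> + 1) / fact k * of_real r powr (2 * of_nat k + \<nu>))
           sums Schlaefli \<nu> (of_real (2 * r))"
proof -
  let ?c = "\<lambda>k::nat. complex_of_real (r ^ k / fact k)"
  let ?A = "\<lambda>k. arc_integral r 1 (\<nu> + of_nat k) + arc_integral r (- 1) (\<nu> + of_nat k)"
  let ?B = "\<lambda>k. ray_integral r (\<nu> + of_nat k)"
  have terms: "(\<lambda>k. (?c k * arc_integral r 1 (\<nu> + of_nat k) + ?c k * arc_integral r (- 1) (\<nu> + of_nat k)) / (2 * of_real pi)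
      - sin (of_real pi * \<nu>) / of_real pi * (of_real ((- r) ^ k / fact k) * ?B k))
      sums Schlaefli \<nu> (of_real (2 * r))"
    unfolding Schlaefli_def
    by (intro sums_diff sums_divide sums_add sums_mult arc_expansion ray_expansion r) auto
  \<comment> \<open>Used with \<open>s\<close> = sin (pi \<nu>), \<open>d\<close> = (-r)^k / k!,
    \<open>c\<close> = r^k / k! and \<open>s'\<close> = sin (pi (\<nu> + k)): the sign of the ray
    expansion is absorbed by the shift of the sine.\<close>
  have factor: "(c * a1 + c * a2) / (2 * p) - s / p * (d * b) = c * ((a1 + a2) / (2 * p) - s' / p * b)"
    if "s * d = c * s'" for a1 a2 b c d p s s' :: complex
  proof -
    have "s / p * (d * b) = (s * d) / p * b" by simp
    also have "\<dots> = c * (s' / p * b)" unfolding that by simp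
    finally show ?thesis by (simp only: right_diff_distrib distrib_left times_divide_eq_right)
  qed
  have "(?c k * arc_integral r 1 (\<nu> + of_nat k) + ?c k * arc_integral r (- 1) (\<nu> + of_nat k)) / (2 * of_real pi)
      - sin (of_real pi * \<nu>) / of_real pi * (of_real ((- r) ^ k / fact k) * ?B k) =
      rGamma (of_nat k + \<nu> + 1) / fact k * of_real r powr (2 * of_nat k + \<nu>)" for k
  proof -
    have "sin (of_real pi * (\<nu> + of_nat k)) = (-1) ^ k * sin (of_real pi * \<nu>)"
    proof -
      have "sin (complex_of_real pi * of_nat k) = of_real (sin (pi * real k))"
        "cos (complex_of_real pi * of_nat k) = of_real (cos (pi * real k))"
        by (simp_all only: sin_of_real [symmetric] cos_of_real [symmetric] of_real_mult of_real_of_nat_eq)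
      then show ?thesis by (simp add: distrib_left sin_add)
    qed
    then have "sin (of_real pi * \<nu>) * (of_real ((- r) ^ k / fact k)) =
        ?c k * sin (of_real pi * (\<nu> + of_nat k))"
      by (simp add: power_minus[of "complex_of_real r"])
    then have "(?c k * arc_integral r 1 (\<nu> + of_nat k) + ?c k * arc_integral r (- 1) (\<nu> + of_nat k)) / (2 * of_real pi)
        - sin (of_real pi * \<nu>) / of_real pi * (of_real ((- r) ^ k / fact k) * ?B k) =
        ?c k * (?A k / (2 * of_real pi) - sin (of_real pi * (\<nu> + of_nat k)) / of_real pi * ?B k)"
      by (rule factor)
    also have "\<dots> = ?c k * (of_real r powr (\<nu> + of_nat k) * rGamma (\<nu> + of_nat k + 1))"
      by (simp only: Hankel_rGamma[OF r])
    also have "\<dots> = rGamma (of_nat k + \<nu> + 1) / fact k * of_real r powr (2 * of_nat k + \<nu>)"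
    proof -
      have "complex_of_real r powr of_nat k = of_real r ^ k"
        using r by (intro powr_nat') auto
      moreover have "2 * of_nat k + \<nu> = of_nat k + (\<nu> + of_nat k)" by simp
      ultimately have "of_real r powr (2 * of_nat k + \<nu>) = complex_of_real r ^ k * of_real r powr (\<nu> + of_nat k)"
        by (simp only: powr_add)
      then show ?thesis by (simp add: add.commute)
    qed
    finally show ?thesis .
  qed
  with terms show ?thesis by (simp only:)
qed

section \<open>Holomorphy in t and continuation to the right half-plane\<close>

text \<open>Separates the only multivalued factor, (t/2)^\<nu>, from a power series in (t/2)^2. At t
  = 0 the convention \<open>0 powr a = 0\<close> would spoil the term k = 0 for \<nu> = 0.\<close>

lemma bessel_I_term_eq:
  fixes t \<nu> :: complex
  assumes "t \<noteq> 0"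
  shows "rGamma (of_nat k + \<nu> + 1) / fact k * (t / 2) powr (2 * of_nat k + \<nu>) =
    (t / 2) powr \<nu> * (rGamma (of_nat k + \<nu> + 1) / fact k * ((t / 2)\<^sup>2) ^ k)"
proof -
  have "(t / 2) powr (2 * of_nat k) = (t / 2) powr of_nat (2 * k)" by simp
  also have "\<dots> = (t / 2) ^ (2 * k)" using assms by (intro powr_nat') auto
  also have "\<dots> = ((t / 2)\<^sup>2) ^ k" by (rule power_mult)
  finally show ?thesis by (simp only: powr_add mult_ac times_divide_eq_right)
qed

text \<open>Instead of a growth estimate for \<open>rGamma\<close>, the sum just obtained at
  positive r is used: the series converges at r^2 for every r > 0, hence everywhere as a power
  series.\<close>

lemma summable_bessel_series:
  "summable (\<lambda>k. rGamma (of_nat k + \<nu> + 1) / fact k * (w::complex) ^ k)"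
proof -
  \<comment> \<open>Chosen so that r^2 > \<open>norm w\<close> whatever the size of
    \<open>w\<close>.\<close>
  define r where "r = norm w + 1"
  have r: "r > 0" "norm w < r\<^sup>2"
    by (auto simp: r_def power2_sum add_nonneg_pos add_pos_nonneg)
  have "summable (\<lambda>k. rGamma (of_nat k + \<nu> + 1) / fact k * of_real r powr (2 * of_nat k + \<nu>))"
    using bessel_I_sums_Schlaefli[OF r(1)] by (rule sums_summable)
  also have "(\<lambda>k. rGamma (of_nat k + \<nu> + 1) / fact k * of_real r powr (2 * of_nat k + \<nu>)) =
      (\<lambda>k. of_real r powr \<nu> * (rGamma (of_nat k + \<nu> + 1) / fact k * (of_real (r\<^sup>2)) ^ k))"
  proof
    have *: "complex_of_real (2 * r) / 2 = of_real r" and nz: "complex_of_real (2 * r) \<noteq> 0"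
      using r(1) by auto
    show "rGamma (of_nat k + \<nu> + 1) / fact k * of_real r powr (2 * of_nat k + \<nu>) =
        of_real r powr \<nu> * (rGamma (of_nat k + \<nu> + 1) / fact k * (of_real (r\<^sup>2)) ^ k)" for k
      using bessel_I_term_eq[OF nz, of k \<nu>] unfolding * of_real_power .
  qed
  finally have "summable (\<lambda>k. rGamma (of_nat k + \<nu> + 1) / fact k * (of_real (r\<^sup>2)) ^ k)"
    using r(1) by (subst (asm) summable_cmult_iff) auto
  then show ?thesis by (rule powser_inside) (use r in \<open>simp add: norm_power\<close>)
qed

lemma holomorphic_bessel_I: "bessel_I \<nu> holomorphic_on {t. Re t > 0}"
proof -
  define g where "g w = (\<Sum>k. rGamma (of_nat k + \<nu> + 1) / fact k * w ^ k)" for w :: complex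
  have g: "g holomorphic_on UNIV"
    unfolding g_def[abs_def] holomorphic_on_def field_differentiable_def
    using termdiffs_strong_converges_everywhere[OF summable_bessel_series] by blast
  have "(\<lambda>t. (t / 2) powr \<nu> * g ((t / 2)\<^sup>2)) holomorphic_on {t. Re t > 0}"
  proof (intro holomorphic_on_mult holomorphic_on_powr)
    have "(\<lambda>t. (t / 2)\<^sup>2) holomorphic_on {t. Re t > 0}" by (intro holomorphic_intros) auto
    from holomorphic_on_compose_gen[OF this g] show "(\<lambda>t. g ((t / 2)\<^sup>2)) holomorphic_on {t. Re t > 0}"
      by (simp add: o_def)
  qed (auto intro!: holomorphic_intros simp: complex_nonpos_Reals_iff)
  moreover have "(t / 2) powr \<nu> * g ((t / 2)\<^sup>2) = bessel_I \<nu> t" if "t \<in> {t. Re t > 0}" for t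
  proof -
    have "t \<noteq> 0" using that by auto
    then show ?thesis unfolding bessel_I_def g_def bessel_I_term_eq[OF \<open>t \<noteq> 0\<close>]
      by (intro suminf_mult [symmetric] summable_bessel_series)
  qed
  ultimately show ?thesis by (rule holomorphic_transform)
qed

text \<open>The arcs are entire in t. On the ray the exponent - cosh x competes with the weight's
  own decay, so the moment condition for all \<open>R\<close> fails, and differentiability is shown
  at each t0 by the local version with a finite radius.\<close>

lemma holomorphic_Schlaefli: "Schlaefli \<nu> holomorphic_on {t. Re t > 0}"
proof -
  have arc: "(\<lambda>t. \<integral>x. exp (t * of_real (cos x)) * exp (- \<i> * of_real (s * x) * \<nu>) \<partial>arc_measure)
      holomorphic_on {t. Re t > 0}" for s
  proof -
    have "exp_moments arc_measure (\<lambda>x. exp (- \<i> * of_real (s * x) * \<nu>)) (\<lambda>x. of_real (cos x))"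
      by (rule exp_moments_interval) (intro continuous_intros)+
    from holomorphic_exp_moments[OF this] show ?thesis by (simp add: mult.commute)
  qed
  have ray: "(\<lambda>t. \<integral>x. exp (- t * of_real (cosh x)) * exp (- of_real x * \<nu>) \<partial>ray_measure)
      field_differentiable (at t0)" if t0: "Re t0 > 0" for t0
  proof -
    \<comment> \<open>The parameter is recentred as t = z + t0. For |z| < Re t0 / 2 half of the
      decay of exp (- t0 cosh x) survives.\<close>
    let ?h = "\<lambda>x. exp (- of_real (cosh x) * t0) * exp (- of_real x * \<nu>)"
    let ?a = "\<lambda>x. - complex_of_real (cosh x)"
    have cont: "continuous_on {0..} ?h" "continuous_on {0..} ?a"
      by (auto simp: cosh_field_def intro!: continuous_intros)
    then have meas: "?h \<in> borel_measurable ray_measure" "?a \<in> borel_measurable ray_measure"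
      by (intro continuous_imp_measurable_on_sets_lebesgue; simp)+
    \<comment> \<open>With exponent function 0 the half-line criterion reduces to plain
      integrability of the surviving weight.\<close>
    have "exp_moments ray_measure (\<lambda>x. exp (- of_real x * \<nu> - of_real (Re t0 / 2 * cosh x))) (\<lambda>x. 0)"
    proof (rule exp_moments_halfline[where A = 0])
      \<comment> \<open>One half is spent on the radius in z, the other comes from cosh x \<ge> e^x
        / 2.\<close>
      show "Re t0 / 4 > 0" using t0 by simp
      show "norm (exp (- of_real x * \<nu> - of_real (Re t0 / 2 * cosh x))) \<le>
          1 * exp (- Re \<nu> * x - Re t0 / 4 * exp x)" if "x \<ge> 0" for x
        using half_exp_le_cosh[of "Re t0 / 2" x] t0 by (simp add: mult.commute)
    qed (auto intro!: continuous_intros)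
    then have "integrable ray_measure (\<lambda>x. norm (exp (- of_real x * \<nu> - of_real (Re t0 / 2 * cosh x))))"
      unfolding exp_moments_def by (auto dest: spec[of _ 0])
    also have "(\<lambda>x. norm (exp (- of_real x * \<nu> - of_real (Re t0 / 2 * cosh x)))) =
        (\<lambda>x. norm (?h x) * exp (Re t0 / 2 * norm (?a x)))"
      by (auto simp: norm_mult algebra_simps simp flip: exp_add)
    finally have "((\<lambda>z. \<integral>x. ?h x * exp (?a x * z) \<partial>ray_measure) has_field_derivative
        (\<integral>x. ?h x * ?a x * exp (?a x * 0) \<partial>ray_measure)) (at 0)"
      using t0 by (intro has_field_derivative_integral_exp[OF meas, where R = "Re t0 / 2"]) auto
    moreover have "?h x * exp (?a x * z) = exp (- (z + t0) * of_real (cosh x)) * exp (- of_real x * \<nu>)" for x z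
      by (simp add: algebra_simps flip: exp_add)
    ultimately have "((\<lambda>z. \<integral>x. exp (- (z + t0) * of_real (cosh x)) * exp (- of_real x * \<nu>) \<partial>ray_measure)
        has_field_derivative (\<integral>x. ?h x * ?a x * exp (?a x * 0) \<partial>ray_measure)) (at 0)"
      by (simp only:)
    then have "((\<lambda>t. \<integral>x. exp (- t * of_real (cosh x)) * exp (- of_real x * \<nu>) \<partial>ray_measure)
        has_field_derivative (\<integral>x. ?h x * ?a x * exp (?a x * 0) \<partial>ray_measure)) (at (0 + t0))"
      by (rule DERIV_shift[THEN iffD2])
    then show ?thesis unfolding add_0 field_differentiable_def by (rule exI)
  qed
  then have "(\<lambda>t. \<integral>x. exp (- t * of_real (cosh x)) * exp (- of_real x * \<nu>) \<partial>ray_measure)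
      holomorphic_on {t. Re t > 0}"
    unfolding holomorphic_on_def by (blast intro: field_differentiable_at_within)
  then show ?thesis unfolding Schlaefli_def[abs_def]
    by (intro holomorphic_intros arc) auto
qed

theorem bessel_I_eq_Schlaefli:
  assumes "Re t > 0"
  shows "bessel_I \<nu> t = Schlaefli \<nu> t"
proof -
  define f where "f t = bessel_I \<nu> t - Schlaefli \<nu> t" for t
  have "f t = 0"
  proof (rule analytic_continuation[where f = f and S = "{t. Re t > 0}" and U = "of_real ` {0<..}"])
    show "f holomorphic_on {t. Re t > 0}"
      unfolding f_def by (intro holomorphic_intros holomorphic_bessel_I holomorphic_Schlaefli)
    show "open {t. Re t > 0}" by (simp add: open_halfspace_Re_gt)
    show "connected {t. Re t > 0}" by (intro convex_connected convex_halfspace_Re_gt)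
    show "complex_of_real 1 islimpt of_real ` {0<..}"
      by (rule islimpt_of_real_image[where y = 2]) auto
    show "f z = 0" if "z \<in> of_real ` {0<..}" for z
    proof -
      from that obtain x where "z = of_real x" "x > 0" by auto
      then show ?thesis using bessel_I_sums_Schlaefli[of "x / 2" \<nu>] by (simp add: f_def bessel_I_def sums_iff)
    qed
  qed (use assms in auto)
  then show ?thesis by (simp add: f_def)
qed

section \<open>Derivatives with respect to the order\<close>

definition arc_moment :: "nat \<Rightarrow> complex \<Rightarrow> real \<Rightarrow> complex \<Rightarrow> complex" where
  "arc_moment n t s \<nu> = (\<integral>x. exp (t * of_real (cos x)) * (- \<i> * of_real (s * x)) ^ n *
     exp (- \<i> * of_real (s * x) * \<nu>) \<partial>arc_measure)"

text \<open>The values s = 1 and s = -1 are the two sides of the cut. Their phase e^(i s pi \<nu>)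
  sits inside the exponential, so differentiation in \<nu> acts on the sine and on e^(-\<nu> x) at
  once.\<close>

definition ray_moment :: "nat \<Rightarrow> complex \<Rightarrow> real \<Rightarrow> complex \<Rightarrow> complex" where
  "ray_moment n t s \<nu> = (\<integral>x. exp (- t * of_real (cosh x)) * (\<i> * of_real (s * pi) - of_real x) ^ n *
     exp ((\<i> * of_real (s * pi) - of_real x) * \<nu>) \<partial>ray_measure)"

definition Schlaefli_moment :: "nat \<Rightarrow> complex \<Rightarrow> complex \<Rightarrow> complex" where
  "Schlaefli_moment n t \<nu> = (arc_moment n t 1 \<nu> + arc_moment n t (- 1) \<nu>) / (2 * of_real pi)
     - (ray_moment n t 1 \<nu> - ray_moment n t (- 1) \<nu>) / (2 * \<i> * of_real pi)"

lemma exp_moments_arc_cos: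
  "exp_moments arc_measure (\<lambda>x. exp (t * of_real (cos x))) (\<lambda>x. - \<i> * of_real (s * x))"
  by (rule exp_moments_interval) (intro continuous_intros)+

lemma exp_moments_ray_cosh:
  assumes "Re t > 0"
  shows "exp_moments ray_measure (\<lambda>x. exp (- t * of_real (cosh x))) (\<lambda>x. \<i> * of_real c - of_real x)"
proof (rule exp_moments_halfline)
  show "norm (exp (- t * of_real (cosh x))) \<le> 1 * exp (0 * x - Re t / 2 * exp x)" if "x \<ge> 0" for x
    using half_exp_le_cosh[of "Re t" x] assms that by simp
  show "norm (\<i> * of_real c - complex_of_real x) \<le> \<bar>c\<bar> + x" if "x \<ge> 0" for x
    using that norm_triangle_ineq4[of "\<i> * of_real c" "complex_of_real x"] by (simp add: norm_mult)
qed (use assms in \<open>auto simp: cosh_field_def intro!: continuous_intros\<close>)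

lemma DERIV_Schlaefli_moment:
  assumes "Re t > 0"
  shows "(Schlaefli_moment n t has_field_derivative Schlaefli_moment (Suc n) t \<nu>) (at \<nu>)"
proof -
  have "(arc_moment n t s has_field_derivative arc_moment (Suc n) t s \<nu>) (at \<nu>)" for s
    unfolding arc_moment_def[abs_def] by (rule DERIV_exp_moments[OF exp_moments_arc_cos])
  moreover have "(ray_moment n t s has_field_derivative ray_moment (Suc n) t s \<nu>) (at \<nu>)" for s
    unfolding ray_moment_def[abs_def] by (rule DERIV_exp_moments[OF exp_moments_ray_cosh[OF assms]])
  ultimately show ?thesis
    unfolding Schlaefli_moment_def[abs_def] by (intro DERIV_diff DERIV_cdivide DERIV_add)
qed

lemma Schlaefli_eq_moment:
  assumes "Re t > 0"
  shows "Schlaefli \<nu> t = Schlaefli_moment 0 t \<nu>"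
proof -
  let ?B = "\<integral>x. exp (- t * of_real (cosh x)) * exp (- of_real x * \<nu>) \<partial>ray_measure"
  have "ray_moment 0 t s \<nu> = exp (\<i> * of_real (s * pi) * \<nu>) * ?B" for s
  proof -
    have "exp ((\<i> * of_real (s * pi) - of_real x) * \<nu>) =
        exp (\<i> * of_real (s * pi) * \<nu>) * exp (- of_real x * \<nu>)" for x
      unfolding exp_add [symmetric] by (simp add: algebra_simps)
    then have "ray_moment 0 t s \<nu> = (\<integral>x. exp (\<i> * of_real (s * pi) * \<nu>) *
        (exp (- t * of_real (cosh x)) * exp (- of_real x * \<nu>)) \<partial>ray_measure)"
      by (simp only: ray_moment_def power_0 mult_1_right mult.left_commute)
    then show ?thesis by simp
  qed
  then have "ray_moment 0 t 1 \<nu> - ray_moment 0 t (- 1) \<nu> =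
      (exp (\<i> * (of_real pi * \<nu>)) - exp (- (\<i> * (of_real pi * \<nu>)))) * ?B"
    by (simp add: left_diff_distrib mult.assoc)
  also have "exp (\<i> * (of_real pi * \<nu>)) - exp (- (\<i> * (of_real pi * \<nu>))) = 2 * \<i> * sin (of_real pi * \<nu>)"
    by (simp add: sin_exp_eq)
  finally show ?thesis
    by (simp add: Schlaefli_def Schlaefli_moment_def arc_moment_def)
qed

text \<open>Stated as an equality of functions, since the induction differentiates it and a value at
  one order would not suffice. The complex derivative in the order restricts to the real
  axis.\<close>

lemma nth_vector_derivative_bessel_I:
  assumes "Re t > 0"
  shows "nth_vector_derivative n (\<lambda>\<mu>. bessel_I (of_real \<mu>) t) = (\<lambda>\<mu>. Schlaefli_moment n t (of_real \<mu>))"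
proof (induction n)
  case 0
  then show ?case
    by (simp add: nth_vector_derivative_def bessel_I_eq_Schlaefli Schlaefli_eq_moment assms)
next
  case (Suc n)
  show ?case
  proof
    fix \<mu> :: real
    have "((\<lambda>\<mu>. Schlaefli_moment n t (of_real \<mu>)) has_vector_derivative
        Schlaefli_moment (Suc n) t (of_real \<mu>)) (at \<mu>)"
      by (rule has_vector_derivative_real_field[OF DERIV_Schlaefli_moment[OF assms]])
    then show "nth_vector_derivative (Suc n) (\<lambda>\<mu>. bessel_I (of_real \<mu>) t) \<mu> =
        Schlaefli_moment (Suc n) t (of_real \<mu>)"
      using Suc by (simp add: nth_vector_derivative_def vector_derivative_at)
  qed
qed

section \<open>Conjugate pairs for real order\<close>

text \<open>For real \<nu> the two integrands are the common factor exp (t cos x) times a conjugate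
  pair, even when t is not real; their sum is twice a real part.\<close>

lemma arc_moment_pair:
  fixes n :: nat and t :: complex and \<nu> :: real
  defines "f \<equiv> \<lambda>x. of_real (x ^ n) * exp (t * of_real (cos x)) * of_real (cos (\<nu> * x + pi / 2 * real n))"
  shows "f absolutely_integrable_on {0..pi}"
    and "arc_moment n t 1 (of_real \<nu>) + arc_moment n t (- 1) (of_real \<nu>) = 2 * integral {0..pi} f"
proof -
  show f: "f absolutely_integrable_on {0..pi}"
    unfolding f_def by (intro absolutely_integrable_continuous_real continuous_intros)
  let ?g = "\<lambda>s x. exp (t * of_real (cos x)) * (- \<i> * of_real (s * x)) ^ n *
     exp (- \<i> * of_real (s * x) * of_real \<nu>)"
  have "?g 1 x + ?g (- 1) x = 2 * f x" for x
  proof -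
    \<comment> \<open>The power i^n = cis (n pi / 2) is the source of the phase shift in the
      cosine.\<close>
    define w where "w = (\<i> * of_real x) ^ n * exp (\<i> * of_real x * of_real \<nu>)"
    have "w = of_real (x ^ n) * cis (\<nu> * x + pi / 2 * real n)"
    proof -
      have "\<i> ^ n = cis (pi / 2 * real n)"
        using Complex.DeMoivre[of "pi / 2" n] by (simp only: cis_pi_half mult.commute)
      moreover have "exp (\<i> * of_real x * of_real \<nu>) = cis (\<nu> * x)"
        by (simp add: cis_conv_exp mult_ac)
      ultimately show ?thesis by (simp add: w_def power_mult_distrib cis_mult add.commute)
    qed
    then have "Re w = x ^ n * cos (\<nu> * x + pi / 2 * real n)" by simp
    moreover have "w + cnj w = of_real (2 * Re w)" by (rule complex_add_cnj)
    moreover have "cnj w = (- \<i> * of_real x) ^ n * exp (- \<i> * of_real x * of_real \<nu>)"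
      by (simp add: w_def exp_cnj)
    moreover have "?g 1 x + ?g (- 1) x = exp (t * of_real (cos x)) *
        (w + (- \<i> * of_real x) ^ n * exp (- \<i> * of_real x * of_real \<nu>))"
      by (simp add: w_def algebra_simps)
    ultimately show ?thesis by (simp add: f_def)
  qed
  then have "(\<integral>x. ?g 1 x + ?g (- 1) x \<partial>arc_measure) = 2 * integral\<^sup>L arc_measure f" by simp
  moreover have "(\<integral>x. ?g 1 x + ?g (- 1) x \<partial>arc_measure) =
      arc_moment n t 1 (of_real \<nu>) + arc_moment n t (- 1) (of_real \<nu>)"
    unfolding arc_moment_def
    by (intro Bochner_Integration.integral_add integrable_exp_moments exp_moments_arc_cos)
  moreover have "integral\<^sup>L arc_measure f = integral {0..pi} f"
    using f by (intro lebesgue_integral_eq_integral)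
      (auto simp: integrable_lebesgue_on_iff_absolutely_integrable)
  ultimately show "arc_moment n t 1 (of_real \<nu>) + arc_moment n t (- 1) (of_real \<nu>) = 2 * integral {0..pi} f"
    by simp
qed

text \<open>The two sides of the cut again give a conjugate pair times a common factor. This time
  the difference is taken, which leaves 2 i times an imaginary part and cancels the 2 i in
  \<open>Schlaefli_moment\<close>.\<close>

lemma ray_moment_pair:
  fixes n :: nat and t :: complex and \<nu> :: real
  assumes t: "Re t > 0"
  defines "f \<equiv> \<lambda>x. exp (- t * of_real (cosh x) - of_real (\<nu> * x))
          * of_real (Im ((\<i> * of_real pi - of_real x) ^ n * exp (\<i> * of_real (pi * \<nu>))))"
  shows "f absolutely_integrable_on {0..}"
    and "ray_moment n t 1 (of_real \<nu>) - ray_moment n t (- 1) (of_real \<nu>) = 2 * \<i> * integral {0..} f"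
proof -
  let ?g = "\<lambda>s x. exp (- t * of_real (cosh x)) * (\<i> * of_real (s * pi) - of_real x) ^ n *
     exp ((\<i> * of_real (s * pi) - of_real x) * of_real \<nu>)"
  have g: "integrable ray_measure (?g s)" for s
    by (intro integrable_exp_moments exp_moments_ray_cosh t)
  have eq: "?g 1 x - ?g (- 1) x = 2 * \<i> * f x" for x
  proof -
    define w where "w = (\<i> * of_real pi - of_real x) ^ n * exp (\<i> * of_real (pi * \<nu>))"
    have "cnj w = (\<i> * of_real (- 1 * pi) - of_real x) ^ n * exp (of_real (- 1) * \<i> * of_real (pi * \<nu>))"
      by (simp add: w_def exp_cnj flip: of_real_mult)
    moreover have "w = (\<i> * of_real (1 * pi) - of_real x) ^ n * exp (of_real 1 * \<i> * of_real (pi * \<nu>))"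
      by (simp add: w_def)
    moreover have "?g s x = exp (- t * of_real (cosh x)) * exp (- of_real (\<nu> * x)) *
        ((\<i> * of_real (s * pi) - of_real x) ^ n * exp (of_real s * \<i> * of_real (pi * \<nu>)))" for s
    proof -
      have *: "exp ((\<i> * of_real (s * pi) - of_real x) * of_real \<nu>) =
          exp (- of_real (\<nu> * x)) * exp (of_real s * \<i> * of_real (pi * \<nu>))"
        unfolding exp_add [symmetric] by (simp add: algebra_simps)
      show ?thesis unfolding * by (simp only: mult_ac)
    qed
    ultimately have "?g 1 x - ?g (- 1) x =
        exp (- t * of_real (cosh x)) * exp (- of_real (\<nu> * x)) * (w - cnj w)"
      by (simp only: right_diff_distrib)
    also have "w - cnj w = 2 * \<i> * of_real (Im w)"
      by (simp add: complex_diff_cnj mult_ac)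
    finally show ?thesis by (simp add: f_def w_def exp_diff exp_minus divide_inverse)
  qed
  \<comment> \<open>Integrability of \<open>f\<close> is inherited from the two complex integrands,
    as \<open>f\<close> is their difference divided by 2 i.\<close>
  have "integrable ray_measure (\<lambda>x. (?g 1 x - ?g (- 1) x) / (2 * \<i>))"
    by (intro integrable_divide_zero Bochner_Integration.integrable_diff g)
  then have f: "integrable ray_measure f" unfolding eq by simp
  then show "f absolutely_integrable_on {0..}"
    by (simp add: integrable_lebesgue_on_iff_absolutely_integrable)
  have "(\<integral>x. ?g 1 x - ?g (- 1) x \<partial>ray_measure) = 2 * \<i> * integral\<^sup>L ray_measure f"
    unfolding eq by simp
  moreover have "(\<integral>x. ?g 1 x - ?g (- 1) x \<partial>ray_measure) =
      ray_moment n t 1 (of_real \<nu>) - ray_moment n t (- 1) (of_real \<nu>)"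
    unfolding ray_moment_def by (intro Bochner_Integration.integral_diff g)
  moreover have "integral\<^sup>L ray_measure f = integral {0..} f"
    using f by (intro lebesgue_integral_eq_integral) auto
  ultimately show "ray_moment n t 1 (of_real \<nu>) - ray_moment n t (- 1) (of_real \<nu>) = 2 * \<i> * integral {0..} f"
    by simp
qed

lemma Im_power_mult_exp:
  "Im ((\<i> * of_real pi - of_real x) ^ n * exp (\<i> * of_real (pi * \<nu>))) =
     p_poly n x * sin (pi * \<nu>) + q_poly n x * cos (pi * \<nu>)"
  by (simp add: p_poly_def q_poly_def Re_exp Im_exp)

text \<open>\<open>vector_derivative\<close> and \<open>integral\<close> are total, so the
  differentiability and absolute integrability conjuncts ensure that the two equations speak of
  genuine derivatives and convergent integrals rather than default values.\<close>

theorem mainTheorem3: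
  fixes n :: nat and \<nu> :: real and t :: complex
  assumes "Re t > 0"
  shows
    "(\<forall>k<n. nth_vector_derivative k (\<lambda>\<mu>. bessel_I (of_real \<mu>) t) differentiable (at \<nu>)) \<and>
     (\<lambda>x. of_real (x ^ n) * exp (t * of_real (cos x)) * of_real (cos (\<nu> * x + pi / 2 * real n)))
       absolutely_integrable_on {0..pi} \<and>
     (\<lambda>x. exp (- t * of_real (cosh x) - of_real (\<nu> * x))
          * of_real (Im ((\<i> * of_real pi - of_real x) ^ n * exp (\<i> * of_real (pi * \<nu>)))))
       absolutely_integrable_on {0..} \<and>
     (\<lambda>x. exp (- t * of_real (cosh x) - of_real (\<nu> * x))
          * of_real (p_poly n x * sin (pi * \<nu>) + q_poly n x * cos (pi * \<nu>)))
       absolutely_integrable_on {0..} \<and>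
     nth_vector_derivative n (\<lambda>\<mu>. bessel_I (of_real \<mu>) t) \<nu>
       = 1 / of_real pi * integral {0..pi}
           (\<lambda>x. of_real (x ^ n) * exp (t * of_real (cos x))
                * of_real (cos (\<nu> * x + pi / 2 * real n)))
         - 1 / of_real pi * integral {0..}
             (\<lambda>x. exp (- t * of_real (cosh x) - of_real (\<nu> * x))
                  * of_real (Im ((\<i> * of_real pi - of_real x) ^ n * exp (\<i> * of_real (pi * \<nu>))))) \<and>
     nth_vector_derivative n (\<lambda>\<mu>. bessel_I (of_real \<mu>) t) \<nu>
       = 1 / of_real pi * integral {0..pi}
           (\<lambda>x. of_real (x ^ n) * exp (t * of_real (cos x))
                * of_real (cos (\<nu> * x + pi / 2 * real n)))
         - 1 / of_real pi * integral {0..}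
             (\<lambda>x. exp (- t * of_real (cosh x) - of_real (\<nu> * x))
                  * of_real (p_poly n x * sin (pi * \<nu>) + q_poly n x * cos (pi * \<nu>)))"
proof -
  have "nth_vector_derivative k (\<lambda>\<mu>. bessel_I (of_real \<mu>) t) differentiable (at \<nu>)" for k
    unfolding nth_vector_derivative_bessel_I[OF assms]
    by (rule differentiableI_vector[OF has_vector_derivative_real_field[OF DERIV_Schlaefli_moment[OF assms]]])
  moreover have "nth_vector_derivative n (\<lambda>\<mu>. bessel_I (of_real \<mu>) t) \<nu>
       = 1 / of_real pi * integral {0..pi}
           (\<lambda>x. of_real (x ^ n) * exp (t * of_real (cos x))
                * of_real (cos (\<nu> * x + pi / 2 * real n)))
         - 1 / of_real pi * integral {0..}
             (\<lambda>x. exp (- t * of_real (cosh x) - of_real (\<nu> * x))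
                  * of_real (Im ((\<i> * of_real pi - of_real x) ^ n * exp (\<i> * of_real (pi * \<nu>)))))"
    unfolding nth_vector_derivative_bessel_I[OF assms] Schlaefli_moment_def
      arc_moment_pair(2) ray_moment_pair(2)[OF assms] by simp
  ultimately show ?thesis
    using arc_moment_pair(1)[of n t \<nu>] ray_moment_pair(1)[OF assms, of \<nu> n]
    unfolding Im_power_mult_exp by blast
qed

end
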